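(* Let $\Phi$ be of type $A_n$. A set $S$ of roots is of the form $S=w(B(I))$ for some $i\in[n]$, $w\in W^i$ and $I\in\mathcal I_{ab}(\alpha_i)$ (i.e. $\operatorname{conv}(S)$ is a simplex of the triangulation $\{\operatorname{conv}(w(B(I)))\mid i\in[n], w\in W^i, I\in\mathcal I_{ab}(\alpha_i)\}$ of the boundary of $\mathcal P$) if and only if $S$ is the set of roots corresponding to an $n$-anti-standard graph.
   Context: $\Phi$ is the root system of type $A_n$ with simple roots $\alpha_1,\dots,\alpha_n$, positive roots $\alpha_{i,j}=\sum_{h=i}^j\alpha_h$ ($1\le i\le j\le n$), highest root $\theta=\alpha_{1,n}$, Weyl group $W$ with length $\ell$, $\mathcal P=\operatorname{conv}(\Phi)$. $W^i=\{w\in W\mid \ell(ws_{\alpha})>\ell(w)\ \forall\alpha\in\Pi\setminus\{\alpha_i\}\}$ (minimal length left coset representatives of $W/W\langle\Pi\setminus\{\alpha_i\}\rangle$). The root poset is $\Phi^+$ with $\beta\ge\gamma$ iff $\beta-\gamma$ is a nonnegative integer combination of simple roots; an abelian ideal is a subset $I\subseteq\Phi^+$ closed upward with $(I+I)\cap\Phi=\emptyset$; its border is $B(I)=\{\beta\in I\mid\gamma_1,\gamma_2\in\Pi,\ \beta-\gamma_1\in\Phi^+,\ \beta-\gamma_2\in\Phi^+\Rightarrow\beta-\gamma_1-\gamma_2\notin I\}$. Affine setup: adjoin $\delta$ with the form extended to have kernel $\mathbb R\delta$; $\widehat\Phi=\Phi+\mathbb Z\delta$, $\widehat\Pi=\Pi\cup\{-\theta+\delta\}$,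 $\widehat\Phi^+=\Phi^+\cup(\Phi+\mathbb Z_{>0}\delta)$, $\widehat W$ generated by reflections in $\widehat\Pi$; $N(w)=\{\beta\in\widehat\Phi^+\mid w^{-1}(\beta)\in-\widehat\Phi^+\}$; $w_I$ is the unique element with $N(w_I)=\{-\beta+\delta\mid\beta\in I\}$; $\mathcal I_{ab}(\alpha)=\{I\mid w_I^{-1}(-\theta+2\delta)=\alpha\}$. An $n$-anti-standard graph is a simple directed graph (no loops, no multiple edges) with vertex set $[n+1]$ and exactly $n$ edges such that (1) every vertex is either a source of some edges or a target of some edges, but not both; (2) for any edges $(s,t)$ and $(s',t')$ (source, target), $s<s'$ implies $t\le t'$. An edge $(i,j)$ with $i<j$ corresponds to the root $\alpha_{i,j-1}$, and an edge $(j,i)$ with $i<j$ to $-\alpha_{i,j-1}$; the set of roots corresponding to a graph is the set of roots of its edges. *)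

theory Defs
  imports Main "HOL-Library.Function_Algebras"
begin

text \<open>Type A_n realised in the standard way: the root lattice inside Z^(n+1),
 vectors are functions nat => int supported on {1..n+1}; e k is the k-th unit vector.\<close>

type_synonym vec = "nat \<Rightarrow> int"

definition e :: "nat \<Rightarrow> vec" where "e k = (\<lambda>m. if m = k then 1 else 0)"

definition smult :: "int \<Rightarrow> vec \<Rightarrow> vec" where "smult c x = (\<lambda>m. c * x m)"

definition ip :: "nat \<Rightarrow> vec \<Rightarrow> vec \<Rightarrow> int" where
  "ip n x y = (\<Sum>k\<in>{1..n+1}. x k * y k)"

definition alpha :: "nat \<Rightarrow> vec" where "alpha h = e h - e (Suc h)"

definition simple_roots :: "nat \<Rightarrow> vec set" where
  "simple_roots n = alpha ` {1..n}"

definition alpha2 :: "nat \<Rightarrow> nat \<Rightarrow> vec" where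
  "alpha2 i j = (\<Sum>h\<in>{i..j}. alpha h)"

definition pos_roots :: "nat \<Rightarrow> vec set" where
  "pos_roots n = {alpha2 i j | i j. 1 \<le> i \<and> i \<le> j \<and> j \<le> n}"

definition roots :: "nat \<Rightarrow> vec set" where
  "roots n = pos_roots n \<union> uminus ` pos_roots n"

definition theta :: "nat \<Rightarrow> vec" where "theta n = alpha2 1 n"

text \<open>reflection in a root a (all roots have squared length 2, so a^vee = a)\<close>
definition refl :: "nat \<Rightarrow> vec \<Rightarrow> vec \<Rightarrow> vec" where
  "refl n a x = x - smult (ip n x a) a"

definition wprod :: "nat \<Rightarrow> nat list \<Rightarrow> (vec \<Rightarrow> vec)" where
  "wprod n hs = foldr (\<lambda>h f. refl n (alpha h) \<circ> f) hs id"

definition weyl :: "nat \<Rightarrow> (vec \<Rightarrow> vec) set" where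
  "weyl n = {wprod n hs | hs. set hs \<subseteq> {1..n}}"

definition len :: "nat \<Rightarrow> (vec \<Rightarrow> vec) \<Rightarrow> nat" where
  "len n w = (LEAST k. \<exists>hs. set hs \<subseteq> {1..n} \<and> length hs = k \<and> w = wprod n hs)"

text \<open>W^i: minimal length left coset representatives\<close>
definition Wi :: "nat \<Rightarrow> nat \<Rightarrow> (vec \<Rightarrow> vec) set" where
  "Wi n i = {w \<in> weyl n. \<forall>h\<in>{1..n} - {i}. len n (w \<circ> refl n (alpha h)) > len n w}"

definition root_ge :: "nat \<Rightarrow> vec \<Rightarrow> vec \<Rightarrow> bool" where
  "root_ge n b c = (\<exists>m :: nat \<Rightarrow> nat. b - c = (\<Sum>h\<in>{1..n}. smult (int (m h)) (alpha h)))"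

definition abelian_ideal :: "nat \<Rightarrow> vec set \<Rightarrow> bool" where
  "abelian_ideal n I = (I \<subseteq> pos_roots n
     \<and> (\<forall>b\<in>I. \<forall>c\<in>pos_roots n. root_ge n c b \<longrightarrow> c \<in> I)
     \<and> (\<forall>x\<in>I. \<forall>y\<in>I. x + y \<notin> roots n))"

definition border :: "nat \<Rightarrow> vec set \<Rightarrow> vec set" where
  "border n I = {b \<in> I. \<forall>g1\<in>simple_roots n. \<forall>g2\<in>simple_roots n.
      b - g1 \<in> pos_roots n \<and> b - g2 \<in> pos_roots n \<longrightarrow> b - g1 - g2 \<notin> I}"

text \<open>Affine setting: a pair (x, k) stands for x + k delta.\<close>
type_synonym avec = "vec \<times> int"

definition aff_roots :: "nat \<Rightarrow> avec set" where
  "aff_roots n = {(a, k) | a k. a \<in> roots n}"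

definition aff_pos_roots :: "nat \<Rightarrow> avec set" where
  "aff_pos_roots n = {(a, 0) | a. a \<in> pos_roots n} \<union> {(a, k) | a k. a \<in> roots n \<and> k > 0}"

definition aff_simple_roots :: "nat \<Rightarrow> avec set" where
  "aff_simple_roots n = {(a, 0) | a. a \<in> simple_roots n} \<union> {(- theta n, 1)}"

definition aneg :: "avec \<Rightarrow> avec" where "aneg p = (- fst p, - snd p)"

text \<open>reflection in an affine real root (b, m): the form has kernel R delta\<close>
definition arefl :: "nat \<Rightarrow> avec \<Rightarrow> avec \<Rightarrow> avec" where
  "arefl n bm xk = (fst xk - smult (ip n (fst xk) (fst bm)) (fst bm),
                    snd xk - ip n (fst xk) (fst bm) * snd bm)"

inductive_set aff_weyl :: "nat \<Rightarrow> (avec \<Rightarrow> avec) set" for n where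
  aw_id: "id \<in> aff_weyl n"
| aw_step: "w \<in> aff_weyl n \<Longrightarrow> b \<in> aff_simple_roots n \<Longrightarrow> arefl n b \<circ> w \<in> aff_weyl n"

definition Ninv :: "nat \<Rightarrow> (avec \<Rightarrow> avec) \<Rightarrow> avec set" where
  "Ninv n w = {b \<in> aff_pos_roots n. inv w b \<in> aneg ` aff_pos_roots n}"

definition wI :: "nat \<Rightarrow> vec set \<Rightarrow> (avec \<Rightarrow> avec)" where
  "wI n I = (THE w. w \<in> aff_weyl n \<and> Ninv n w = {(- b, 1) | b. b \<in> I})"

definition Iab :: "nat \<Rightarrow> vec \<Rightarrow> vec set set" where
  "Iab n a = {I. abelian_ideal n I \<and> inv (wI n I) (- theta n, 2) = (a, 0)}"

definition anti_standard :: "nat \<Rightarrow> (nat \<times> nat) set \<Rightarrow> bool" where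
  "anti_standard n E = (E \<subseteq> {1..n+1} \<times> {1..n+1}
     \<and> (\<forall>(s, t)\<in>E. s \<noteq> t)
     \<and> card E = n
     \<and> (\<forall>v\<in>{1..n+1}. (\<exists>t. (v, t) \<in> E) \<noteq> (\<exists>s. (s, v) \<in> E))
     \<and> (\<forall>(s, t)\<in>E. \<forall>(s', t')\<in>E. s < s' \<longrightarrow> t \<le> t'))"

definition edge_root :: "nat \<times> nat \<Rightarrow> vec" where
  "edge_root st = (if fst st < snd st then alpha2 (fst st) (snd st - 1)
                   else - alpha2 (snd st) (fst st - 1))"

definition graph_roots :: "(nat \<times> nat) set \<Rightarrow> vec set" where
  "graph_roots E = edge_root ` E"

end

theory Submission
  imports Defs "HOL-Combinatorics.Permutations" "HOL-Library.Infinite_Set"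
begin

text \<open>With roots written as \<open>e\<^sub>a - e\<^sub>b\<close>, an abelian ideal is a set of cells \<open>(a, b)\<close>, and
  \<open>w\<^sub>I\<^sup>-\<^sup>1\<close> is the affine permutation with window \<open>c + |column c| - |row c|\<close>. Reading off its
  action on \<open>-\<theta> + 2\<delta>\<close> shows that \<open>I\<close> belongs to \<open>\<alpha>\<^sub>i\<close> iff \<open>I\<close> contains both
  \<open>(1, i+1)\<close> and \<open>(i, n+1)\<close>. The borders of these ideals are exactly the monotone lattice
  paths of \<open>n\<close> cells through the rectangle \<open>{1..i} \<times> {i+1..n+1}\<close>, that is, the
  anti-standard graphs whose sources are \<open>1, \<dots>, i\<close>. The elements of \<open>W\<^sup>i\<close> are the
  permutations increasing on \<open>{1..i}\<close> and on \<open>{i+1..n+1}\<close>; they move the sources to an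
  arbitrary \<open>i\<close>-element set while keeping the orders among sources and among targets.\<close>

section \<open>Roots\<close>

text \<open>\<open>wI\<close> is a definite description, so nothing can be read off it before
  exactly one element of \<open>aff_weyl\<close> is known to have the prescribed inversion set. As
  \<open>aff_weyl\<close> is given by generators, it is first identified with all pairs of a
  permutation and an integer shift of sum zero; existence then amounts to exhibiting a suitable
  window. Dictionary: the affine root \<open>(rt a b, m)\<close> stands for the positions
  \<open>a\<close> and \<open>b + (n+1) * m\<close>, and it is positive iff the first is the smaller
  one. An inversion is such a pair whose order is reversed; it pushes the value at the earlier
  position up by one and the value at the later position down by one. The cell \<open>(a, b)\<close>
  of an ideal is the inversion of the positions \<open>b\<close> and \<open>a + (n+1)\<close>, which
  explains the plus sign for columns and the minus sign for rows. The root
  \<open>(- theta n, 2)\<close> is the pair \<open>n+1\<close>, \<open>1 + 2 * (n+1)\<close>. It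
  goes to some \<open>alpha i\<close> iff the two images are consecutive integers, the smaller one
  congruent to \<open>i\<close>; so row 1 and column \<open>n+1\<close> must contain
  \<open>n+1\<close> cells in all, and their sizes determine \<open>i\<close>.\<close>

definition idx :: "nat \<Rightarrow> nat set" where "idx n = {1..n+1}"

definition rt :: "nat \<Rightarrow> nat \<Rightarrow> vec" where "rt a b = e a - e b"

lemma finite_idx [simp]: "finite (idx n)"
  by (simp add: idx_def)

lemma card_idx [simp]: "card (idx n) = Suc n"
  by (simp add: idx_def)

lemma idx_iff: "a \<in> idx n \<longleftrightarrow> 1 \<le> a \<and> a \<le> Suc n"
  by (auto simp: idx_def)

lemma rt_apply: "rt a b m = (if m = a then 1 else 0) - (if m = b then 1 else 0)"
  by (simp add: rt_def e_def)

text \<open>The pair is recovered as the positions of the entries 1 and -1; \<open>rt a a\<close> is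
  zero for every \<open>a\<close> and carries no such information.\<close>

lemma rt_eq_iff:
  assumes "a \<noteq> b"
  shows "rt a b = rt c d \<longleftrightarrow> a = c \<and> b = d"
proof
  assume eq: "rt a b = rt c d"
  have "rt c d a = 1" "rt c d b = -1"
    using assms by (auto simp flip: eq simp: rt_apply)
  then show "a = c \<and> b = d"
    by (auto simp: rt_apply split: if_splits)
qed auto

lemma uminus_rt: "- rt a b = rt b a"
  by (simp add: rt_def)

lemma alpha_eq_rt: "alpha h = rt h (Suc h)"
  by (simp add: alpha_def rt_def)

lemma alpha2_eq_rt:
  assumes "i \<le> j"
  shows "alpha2 i j = rt i (Suc j)"
proof -
  have "alpha2 i j = - (\<Sum>h=i..j. e (Suc h) - e h)"
    unfolding alpha2_def alpha_def by (simp flip: sum_negf)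
  then show ?thesis
    using assms by (simp add: sum_Suc_diff rt_def)
qed

lemma pos_roots_eq: "pos_roots n = {rt a b | a b. a \<in> idx n \<and> b \<in> idx n \<and> a < b}"
proof (intro equalityI subsetI)
  fix x assume "x \<in> pos_roots n"
  then obtain i j where "x = alpha2 i j" "1 \<le> i" "i \<le> j" "j \<le> n"
    by (auto simp: pos_roots_def)
  then show "x \<in> {rt a b | a b. a \<in> idx n \<and> b \<in> idx n \<and> a < b}"
    by (intro CollectI exI[of _ i] exI[of _ "Suc j"]) (auto simp: alpha2_eq_rt idx_iff)
next
  fix x assume "x \<in> {rt a b | a b. a \<in> idx n \<and> b \<in> idx n \<and> a < b}"
  then obtain a b where "x = rt a b" "a \<in> idx n" "b \<in> idx n" "a < b"
    by auto
  then show "x \<in> pos_roots n"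
    unfolding pos_roots_def
    by (intro CollectI exI[of _ a] exI[of _ "b - 1"]) (auto simp: alpha2_eq_rt idx_iff)
qed

lemma rt_in_pos_roots:
  assumes "a \<in> idx n" "b \<in> idx n"
  shows "rt a b \<in> pos_roots n \<longleftrightarrow> a < b"
proof
  assume "rt a b \<in> pos_roots n"
  then obtain c d where "rt c d = rt a b" "c < d"
    unfolding pos_roots_eq by auto
  then show "a < b"
    by (metis nat_neq_iff rt_eq_iff)
qed (use assms in \<open>auto simp: pos_roots_eq\<close>)

lemma rt_pos_rootsD:
  assumes "rt a b \<in> pos_roots n"
  shows "a < b" "a \<in> idx n" "b \<in> idx n"
proof -
  obtain c d where "rt c d = rt a b" "c < d" "c \<in> idx n" "d \<in> idx n"
    using assms unfolding pos_roots_eq by auto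
  then show "a < b" "a \<in> idx n" "b \<in> idx n"
    by (metis nat_neq_iff rt_eq_iff)+
qed

lemma roots_eq: "roots n = {rt a b | a b. a \<in> idx n \<and> b \<in> idx n \<and> a \<noteq> b}"
proof (intro equalityI subsetI)
  fix x assume "x \<in> roots n"
  then show "x \<in> {rt a b | a b. a \<in> idx n \<and> b \<in> idx n \<and> a \<noteq> b}"
    unfolding roots_def pos_roots_eq by (auto simp: uminus_rt) (metis nat_neq_iff)+
next
  fix x assume "x \<in> {rt a b | a b. a \<in> idx n \<and> b \<in> idx n \<and> a \<noteq> b}"
  then obtain a b where ab: "x = rt a b" "a \<in> idx n" "b \<in> idx n" "a \<noteq> b"
    by auto
  then consider "a < b" | "b < a" by linarith
  then show "x \<in> roots n"
  proof cases
    case 1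
    then show ?thesis using ab by (simp add: roots_def rt_in_pos_roots)
  next
    case 2
    then have "rt b a \<in> pos_roots n" using ab by (simp add: rt_in_pos_roots)
    then have "- rt b a \<in> roots n" unfolding roots_def by blast
    then show ?thesis using ab by (simp add: uminus_rt)
  qed
qed

lemma simple_roots_eq: "simple_roots n = {rt h (Suc h) | h. 1 \<le> h \<and> h \<le> n}"
  by (auto simp: simple_roots_def alpha_eq_rt)

lemma theta_eq_rt: "n \<ge> 1 \<Longrightarrow> theta n = rt 1 (Suc n)"
  by (simp add: theta_def alpha2_eq_rt)

lemma edge_root_eq_rt: "s \<noteq> t \<Longrightarrow> edge_root (s, t) = rt s t"
  by (auto simp: edge_root_def alpha2_eq_rt uminus_rt)

lemma ip_rt:
  assumes "a \<in> idx n" "b \<in> idx n"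
  shows "ip n x (rt a b) = x a - x b"
proof -
  have "ip n x (rt a b) = (\<Sum>k\<in>idx n. (if k = a then x k else 0) - (if k = b then x k else 0))"
    unfolding ip_def idx_def[symmetric] by (rule sum.cong) (auto simp: rt_apply)
  then show ?thesis
    using assms by (simp add: sum_subtractf)
qed

lemma refl_rt:
  assumes "a \<in> idx n" "b \<in> idx n"
  shows "refl n (rt a b) x = x \<circ> transpose a b"
  using assms by (auto simp: refl_def ip_rt smult_def rt_apply transpose_def fun_eq_iff)

lemma arefl_rt:
  assumes "a \<in> idx n" "b \<in> idx n"
  shows "arefl n (rt a b, m) (x, k) = (x \<circ> transpose a b, k - (x a - x b) * m)"
  using refl_rt[OF assms, of x] assms by (simp add: arefl_def refl_def ip_rt)

lemma smult_sum_apply: "(\<Sum>h\<in>A. smult (f h) (g h)) j = (\<Sum>h\<in>A. f h * g h j)"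
  by (induction A rule: infinite_finite_induct) (auto simp: smult_def)

text \<open>Summing the first \<open>j\<close> coordinates isolates the coefficient of
  \<open>alpha j\<close>, so these sums are nonnegative for a nonnegative combination. Conversely,
  \<open>rt a b - rt c d = rt a c + rt d b\<close> consists of two runs of simple roots.\<close>

lemma root_ge_rt:
  assumes "rt a b \<in> pos_roots n" "rt c d \<in> pos_roots n"
  shows "root_ge n (rt a b) (rt c d) \<longleftrightarrow> a \<le> c \<and> d \<le> b"
proof
  assume "root_ge n (rt a b) (rt c d)"
  then obtain m :: "nat \<Rightarrow> nat"
    where m: "rt a b - rt c d = (\<Sum>h\<in>{1..n}. smult (int (m h)) (alpha h))"
    unfolding root_ge_def by blast
  have partial: "0 \<le> (\<Sum>k=1..j. (rt a b - rt c d) k)" for j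
  proof -
    have "(\<Sum>k=1..j. (rt a b - rt c d) k)
        = (\<Sum>h\<in>{1..n}. int (m h) * (\<Sum>k=1..j. alpha h k))"
      unfolding m smult_sum_apply by (subst sum.swap) (simp add: sum_distrib_left)
    also have "\<dots> \<ge> 0"
    proof (rule sum_nonneg)
      fix h assume "h \<in> {1..n}"
      then have "0 \<le> (\<Sum>k=1..j. alpha h k)"
        by (auto simp: alpha_eq_rt rt_apply sum_subtractf)
      then show "0 \<le> int (m h) * (\<Sum>k=1..j. alpha h k)"
        by simp
    qed
    finally show ?thesis .
  qed
  have "1 \<le> a" "1 \<le> c" "a < b" "c < d"
    using rt_pos_rootsD[OF assms(1)] rt_pos_rootsD[OF assms(2)] by (auto simp: idx_iff)
  \<comment> \<open>The first \<open>j\<close> coordinates of \<open>rt c d\<close> sum to 1 exactly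
    for \<open>c \<le> j < d\<close>; testing both ends of this range forces it into the range of
    \<open>rt a b\<close>.\<close>
  then show "a \<le> c \<and> d \<le> b"
    using partial[of c] partial[of "d - 1"]
    by (auto simp: rt_apply sum_subtractf split: if_splits)
next
  assume ac: "a \<le> c \<and> d \<le> b"
  have dom: "1 \<le> a" "c < d" "b \<le> Suc n"
    using rt_pos_rootsD[OF assms(1)] rt_pos_rootsD[OF assms(2)] by (auto simp: idx_iff)
  have tel: "(\<Sum>h\<in>{1..n}. smult (int (of_bool (h \<in> {p..<q}))) (alpha h)) = rt p q"
    if "1 \<le> p" "p \<le> q" "q \<le> Suc n" for p q
  proof -
    have "(\<Sum>h\<in>{1..n}. smult (int (of_bool (h \<in> {p..<q}))) (alpha h)) = (\<Sum>h\<in>{p..<q}. alpha h)"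
      using that by (intro sum.mono_neutral_cong_right) (auto simp: smult_def zero_fun_def)
    also have "\<dots> = - (\<Sum>h\<in>{p..<q}. e (Suc h) - e h)"
      unfolding alpha_def by (simp flip: sum_negf)
    also have "\<dots> = rt p q"
      using that by (simp add: sum_Suc_diff' rt_def)
    finally show ?thesis .
  qed
  define m :: "nat \<Rightarrow> nat" where "m h = of_bool (h \<in> {a..<c}) + of_bool (h \<in> {d..<b})" for h
  have "smult (int (m h)) (alpha h) = smult (int (of_bool (h \<in> {a..<c}))) (alpha h)
      + smult (int (of_bool (h \<in> {d..<b}))) (alpha h)" for h
    by (auto simp: m_def smult_def)
  then have "(\<Sum>h\<in>{1..n}. smult (int (m h)) (alpha h)) = rt a c + rt d b"
    using ac dom tel[of a c] tel[of d b] by (simp add: sum.distrib del: One_nat_def)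
  then show "root_ge n (rt a b) (rt c d)"
    unfolding root_ge_def by (intro exI[of _ m]) (simp add: rt_def)
qed

section \<open>The Weyl group\<close>

text \<open>The inverse makes this a left action, sending \<open>e a\<close> to
  \<open>e (s a)\<close>; precomposing with \<open>s\<close> itself would reverse products.\<close>

definition perm_act :: "(nat \<Rightarrow> nat) \<Rightarrow> vec \<Rightarrow> vec" where
  "perm_act s x = x \<circ> inv s"

lemma perm_act_rt:
  assumes "bij s"
  shows "perm_act s (rt a b) = rt (s a) (s b)"
proof -
  have "inv s m = c \<longleftrightarrow> m = s c" for m c
    using assms by (metis bij_inv_eq_iff)
  then show ?thesis
    by (simp add: perm_act_def rt_apply fun_eq_iff)
qed

lemma perm_act_id [simp]: "perm_act id = id"
  by (auto simp: perm_act_def fun_eq_iff)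

lemma perm_act_comp: "bij s \<Longrightarrow> bij t \<Longrightarrow> perm_act s \<circ> perm_act t = perm_act (s \<circ> t)"
  by (auto simp: perm_act_def fun_eq_iff o_inv_distrib)

lemma perm_act_inj:
  assumes "bij s" "bij t" "perm_act s = perm_act t"
  shows "s = t"
proof
  fix a
  have "rt (s a) (s (Suc a)) = rt (t a) (t (Suc a))"
    using assms by (metis perm_act_rt)
  moreover have "s a \<noteq> s (Suc a)"
    using assms(1) by (metis bij_pointE n_not_Suc_n)
  ultimately show "s a = t a" by (simp add: rt_eq_iff)
qed

lemma refl_alpha:
  assumes "h \<in> {1..n}"
  shows "refl n (alpha h) = perm_act (transpose h (Suc h))"
  using assms by (auto simp: alpha_eq_rt refl_rt idx_iff perm_act_def fun_eq_iff)

lemma transpose_permutes_idx: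
  assumes "h \<in> {1..n}"
  shows "transpose h (Suc h) permutes idx n"
  using assms by (intro permutes_swap_id) (auto simp: idx_iff)

section \<open>Inversions, Coxeter length and minimal coset representatives\<close>

definition inversions :: "nat \<Rightarrow> (nat \<Rightarrow> nat) \<Rightarrow> (nat \<times> nat) set" where
  "inversions n s = {(a, b). a \<in> idx n \<and> b \<in> idx n \<and> a < b \<and> s b < s a}"

lemma finite_inversions [simp]: "finite (inversions n s)"
  by (rule finite_subset[of _ "idx n \<times> idx n"]) (auto simp: inversions_def)

lemma inversions_id [simp]: "inversions n id = {}"
  by (auto simp: inversions_def)

text \<open>An adjacent transposition changes the order of no pair except \<open>h\<close>,
  \<open>Suc h\<close>. Applied to both entries, it therefore matches the old inversions with all
  new ones other than \<open>(h, Suc h)\<close>.\<close>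

lemma card_inversions_ascent:
  assumes h: "h \<in> {1..n}" and asc: "s h < s (Suc h)"
  shows "card (inversions n (s \<circ> transpose h (Suc h))) = Suc (card (inversions n s))"
proof -
  let ?t = "transpose h (Suc h)"
  let ?f = "\<lambda>(a, b). (?t a, ?t b)"
  have inv: "?t (?t a) = a" for a by simp
  have mem: "?t a \<in> idx n \<longleftrightarrow> a \<in> idx n" for a
    using h by (auto simp: transpose_def idx_iff)
  have less: "?t a < ?t b \<longleftrightarrow> a < b" if "(a, b) \<noteq> (h, Suc h)" "(a, b) \<noteq> (Suc h, h)" for a b
    using that by (auto simp: transpose_def)
  have "inversions n (s \<circ> ?t) = insert (h, Suc h) (?f ` inversions n s)"
  proof (intro equalityI subsetI)
    fix p assume "p \<in> inversions n (s \<circ> ?t)"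
    then obtain a b where p: "p = (a, b)" "a \<in> idx n" "b \<in> idx n" "a < b" "s (?t b) < s (?t a)"
      by (auto simp: inversions_def)
    show "p \<in> insert (h, Suc h) (?f ` inversions n s)"
    proof (cases "(a, b) = (h, Suc h)")
      case False
      then have "(?t a, ?t b) \<in> inversions n s"
        using p less[of a b] by (auto simp: inversions_def mem)
      then have "?f (?t a, ?t b) \<in> ?f ` inversions n s" by (rule imageI)
      then show ?thesis by (simp add: p)
    qed (simp add: p)
  next
    fix p assume "p \<in> insert (h, Suc h) (?f ` inversions n s)"
    then consider "p = (h, Suc h)" | a b where "p = (?t a, ?t b)" "(a, b) \<in> inversions n s"
      by auto
    then show "p \<in> inversions n (s \<circ> ?t)"
    proof cases
      case 1
      then show ?thesis using h asc by (auto simp: inversions_def idx_iff)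
    next
      case 2
      then have "(a, b) \<noteq> (h, Suc h)" "(a, b) \<noteq> (Suc h, h)"
        using asc by (auto simp: inversions_def)
      from less[OF this] show ?thesis using 2 by (auto simp: inversions_def mem)
    qed
  qed
  moreover have "(h, Suc h) \<notin> ?f ` inversions n s"
  proof
    assume "(h, Suc h) \<in> ?f ` inversions n s"
    then obtain p where "p \<in> inversions n s" "(h, Suc h) = ?f p"
      by (rule imageE)
    then obtain a b where "h = ?t a" "Suc h = ?t b" "a < b"
      by (cases p) (auto simp: inversions_def)
    then have "a = Suc h" "b = h" "a < b"
      by (auto simp: transpose_def split: if_splits)
    then show False by simp
  qed
  moreover have "inj_on ?f (inversions n s)"
    by (rule inj_on_inverseI[where g = ?f]) auto
  ultimately show ?thesis
    by (simp add: card_image)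
qed

lemma card_inversions_descent:
  assumes h: "h \<in> {1..n}" and desc: "s (Suc h) < s h"
  shows "Suc (card (inversions n (s \<circ> transpose h (Suc h)))) = card (inversions n s)"
proof -
  let ?t = "transpose h (Suc h)"
  have "card (inversions n ((s \<circ> ?t) \<circ> ?t)) = Suc (card (inversions n (s \<circ> ?t)))"
    by (rule card_inversions_ascent) (use assms in auto)
  moreover have "(s \<circ> ?t) \<circ> ?t = s"
    by (auto simp: fun_eq_iff)
  ultimately show ?thesis by simp
qed

lemma less_of_consecutive_less:
  fixes s :: "nat \<Rightarrow> nat"
  assumes "\<And>h. p \<le> h \<Longrightarrow> h < q \<Longrightarrow> s h < s (Suc h)" "p \<le> a" "a < b" "b \<le> q"
  shows "s a < s b"
proof -
  have "Suc a \<le> b" using assms by simp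
  then show ?thesis using \<open>b \<le> q\<close>
  proof (induction b rule: dec_induct)
    case base
    then show ?case using assms by simp
  next
    case (step m)
    then show ?case using assms(1)[of m] \<open>p \<le> a\<close> by auto
  qed
qed

text \<open>An order preserving \<open>s\<close> maps the elements below \<open>a\<close> onto those
  below \<open>s a\<close>; counting both sets gives \<open>s a = a\<close>.\<close>

lemma increasing_permutes_id:
  assumes s: "s permutes idx n" and inc: "\<And>h. h \<in> {1..n} \<Longrightarrow> s h < s (Suc h)"
  shows "s = id"
proof -
  have mono: "s a < s b" if "a \<in> idx n" "b \<in> idx n" "a < b" for a b
    by (rule less_of_consecutive_less[of 1 "Suc n" s]) (use inc that in \<open>auto simp: idx_iff\<close>)
  have "s a = a" if "a \<in> idx n" for a
  proof -
    have bij: "bij_betw s (idx n) (idx n)" by (rule permutes_imp_bij[OF s])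
    have "s ` {x \<in> idx n. x < a} = {x \<in> idx n. x < s a}"
    proof (intro equalityI subsetI)
      fix y assume y: "y \<in> {x \<in> idx n. x < s a}"
      then obtain x where "y = s x" "x \<in> idx n"
        using bij by (auto simp: bij_betw_def)
      then show "y \<in> s ` {x \<in> idx n. x < a}"
        using y mono[of a x] that by (cases rule: linorder_cases[of a x]) simp_all
    qed (use mono that permutes_in_image[OF s] in auto)
    moreover have "card (s ` {x \<in> idx n. x < a}) = card {x \<in> idx n. x < a}"
      by (rule card_image) (meson permutes_inj_on[OF s])
    moreover have "{x \<in> idx n. x < c} = {1..<c}" if "c \<in> idx n" for c
      using that by (auto simp: idx_iff)
    moreover have "s a \<in> idx n" using permutes_in_image[OF s] that by simp
    ultimately show ?thesis using that by (auto simp: idx_iff)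
  qed
  then show ?thesis
    using permutes_not_in[OF s] by (intro ext) (metis id_apply)
qed

lemma wprod_snoc:
  "wprod n (hs @ [h]) = wprod n hs \<circ> refl n (alpha h)"
  unfolding wprod_def by (induction hs) auto

text \<open>One generator raises the number of inversions by at most one, so this number bounds the
  length of every word from below.\<close>

lemma wprod_is_perm_act:
  assumes "set hs \<subseteq> {1..n}"
  obtains s where "s permutes idx n" "wprod n hs = perm_act s" "card (inversions n s) \<le> length hs"
proof -
  have "\<exists>s. s permutes idx n \<and> wprod n hs = perm_act s \<and> card (inversions n s) \<le> length hs"
    using assms
  proof (induction hs rule: rev_induct)
    case Nil
    have "wprod n [] = perm_act id" by (simp add: wprod_def)
    moreover have "card (inversions n id) \<le> length []" by simp
    ultimately show ?case using permutes_id by blast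
  next
    case (snoc h hs)
    then obtain s where s: "s permutes idx n" "wprod n hs = perm_act s"
        "card (inversions n s) \<le> length hs" by auto
    have h: "h \<in> {1..n}" using snoc.prems by auto
    let ?t = "transpose h (Suc h)"
    have t: "?t permutes idx n" using h by (rule transpose_permutes_idx)
    have "s h \<noteq> s (Suc h)"
      using permutes_inj[OF s(1)] by (simp add: inj_eq)
    then have "card (inversions n (s \<circ> ?t)) \<le> Suc (card (inversions n s))"
      using card_inversions_ascent[OF h, of s] card_inversions_descent[OF h, of s]
      by (cases "s h < s (Suc h)") auto
    moreover have "wprod n (hs @ [h]) = perm_act (s \<circ> ?t)"
      using s(1) t h by (simp add: wprod_snoc s(2) refl_alpha perm_act_comp permutes_bij)
    moreover have "Suc (card (inversions n s)) \<le> length (hs @ [h])" using s(3) by simp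
    ultimately show ?case
      using permutes_compose[OF t s(1)] order_trans by blast
  qed
  then show thesis using that by blast
qed

text \<open>Bubble sort: a permutation other than the identity has a descent, and undoing it removes
  exactly one inversion. The resulting word attains the lower bound of
  \<open>wprod_is_perm_act\<close>.\<close>

lemma perm_act_is_wprod:
  assumes "s permutes idx n"
  shows "\<exists>hs. set hs \<subseteq> {1..n} \<and> length hs = card (inversions n s) \<and> perm_act s = wprod n hs"
  using assms
proof (induction "card (inversions n s)" arbitrary: s rule: less_induct)
  case less
  show ?case
  proof (cases "\<forall>h\<in>{1..n}. s h < s (Suc h)")
    case True
    then have "s = id" using increasing_permutes_id[OF less.prems] by blast
    then show ?thesis
      by (intro exI[of _ "[]"]) (simp add: wprod_def)
  next
    case False
    then obtain h where h: "h \<in> {1..n}" "\<not> s h < s (Suc h)" by blast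
    moreover have "s h \<noteq> s (Suc h)"
      using permutes_inj[OF less.prems] by (simp add: inj_eq)
    ultimately have desc: "s (Suc h) < s h" by simp
    let ?t = "transpose h (Suc h)"
    have t: "?t permutes idx n" using h by (intro transpose_permutes_idx)
    have st: "s \<circ> ?t permutes idx n" using permutes_compose[OF t less.prems] .
    obtain hs where hs: "set hs \<subseteq> {1..n}" "length hs = card (inversions n (s \<circ> ?t))"
        "perm_act (s \<circ> ?t) = wprod n hs"
      using less.hyps[OF _ st] card_inversions_descent[OF h(1) desc] by auto
    have "wprod n (hs @ [h]) = perm_act ((s \<circ> ?t) \<circ> ?t)"
      using st t h by (simp add: wprod_snoc refl_alpha perm_act_comp permutes_bij flip: hs(3))
    moreover have "(s \<circ> ?t) \<circ> ?t = s" by (auto simp: fun_eq_iff)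
    ultimately show ?thesis
      using hs h card_inversions_descent[OF h(1) desc] by (intro exI[of _ "hs @ [h]"]) auto
  qed
qed

lemma weyl_eq: "weyl n = perm_act ` {s. s permutes idx n}"
proof (intro equalityI subsetI)
  fix w assume "w \<in> weyl n"
  then show "w \<in> perm_act ` {s. s permutes idx n}"
    unfolding weyl_def using wprod_is_perm_act[of _ n] by blast
next
  fix w assume "w \<in> perm_act ` {s. s permutes idx n}"
  then show "w \<in> weyl n"
    unfolding weyl_def using perm_act_is_wprod by blast
qed

lemma len_perm_act:
  assumes "s permutes idx n"
  shows "len n (perm_act s) = card (inversions n s)"
  unfolding len_def
proof (rule Least_equality)
  show "\<exists>hs. set hs \<subseteq> {1..n} \<and> length hs = card (inversions n s) \<and> perm_act s = wprod n hs"
    using perm_act_is_wprod[OF assms] .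
next
  fix k assume "\<exists>hs. set hs \<subseteq> {1..n} \<and> length hs = k \<and> perm_act s = wprod n hs"
  then obtain hs where hs: "set hs \<subseteq> {1..n}" "length hs = k" "perm_act s = wprod n hs"
    by blast
  obtain t where t: "t permutes idx n" "wprod n hs = perm_act t" "card (inversions n t) \<le> k"
    using wprod_is_perm_act[OF hs(1)] hs(2) by auto
  then have "s = t"
    using assms hs(3) by (intro perm_act_inj) (auto simp: permutes_bij)
  then show "card (inversions n s) \<le> k" using t by simp
qed

lemma len_ascent_iff:
  assumes s: "s permutes idx n" and h: "h \<in> {1..n}"
  shows "len n (perm_act s) < len n (perm_act s \<circ> refl n (alpha h)) \<longleftrightarrow> s h < s (Suc h)"
proof -
  let ?t = "transpose h (Suc h)"
  have t: "?t permutes idx n" using h by (intro transpose_permutes_idx)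
  have "perm_act s \<circ> refl n (alpha h) = perm_act (s \<circ> ?t)"
    using s t h by (simp add: refl_alpha perm_act_comp permutes_bij)
  moreover have "s h \<noteq> s (Suc h)"
    using permutes_inj[OF s] by (simp add: inj_eq)
  ultimately show ?thesis
    using card_inversions_ascent[OF h, of s] card_inversions_descent[OF h, of s]
      len_perm_act[OF s] len_perm_act[OF permutes_compose[OF t s]]
    by (cases "s h < s (Suc h)") auto
qed

text \<open>A generator lengthens the element iff it acts at an ascent; ascents chain together on
  either side of \<open>i\<close>, the only place where the order may break.\<close>

lemma Wi_eq:
  assumes "i \<in> {1..n}"
  shows "Wi n i = perm_act `
    {s. s permutes idx n \<and> strict_mono_on {1..i} s \<and> strict_mono_on {Suc i..Suc n} s}"
proof -
  have "(\<forall>h\<in>{1..n}-{i}. s h < s (Suc h))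
      \<longleftrightarrow> strict_mono_on {1..i} s \<and> strict_mono_on {Suc i..Suc n} s" for s :: "nat \<Rightarrow> nat"
  proof (intro iffI conjI)
    assume *: "\<forall>h\<in>{1..n}-{i}. s h < s (Suc h)"
    show "strict_mono_on {1..i} s"
      by (intro strict_mono_onI, rule less_of_consecutive_less[of 1 i s])
        (use assms * in auto)
    show "strict_mono_on {Suc i..Suc n} s"
      by (intro strict_mono_onI, rule less_of_consecutive_less[of "Suc i" "Suc n" s])
        (use assms * in auto)
  next
    assume *: "strict_mono_on {1..i} s \<and> strict_mono_on {Suc i..Suc n} s"
    show "\<forall>h\<in>{1..n}-{i}. s h < s (Suc h)"
    proof
      fix h assume "h \<in> {1..n}-{i}"
      then consider "h \<in> {1..i}" "Suc h \<in> {1..i}" | "h \<in> {Suc i..Suc n}" "Suc h \<in> {Suc i..Suc n}"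
        by force
      then show "s h < s (Suc h)"
        by cases (use * in \<open>auto simp: strict_mono_on_def\<close>)
    qed
  qed
  moreover have "Wi n i = perm_act ` {s. s permutes idx n \<and> (\<forall>h\<in>{1..n}-{i}. s h < s (Suc h))}"
  proof -
    have "perm_act s \<in> Wi n i \<longleftrightarrow> (\<forall>h\<in>{1..n}-{i}. s h < s (Suc h))" if "s permutes idx n" for s
      using that len_ascent_iff[OF that] by (simp add: Wi_def weyl_eq)
    moreover have "Wi n i \<subseteq> perm_act ` {s. s permutes idx n}"
      by (simp add: Wi_def weyl_eq)
    ultimately show ?thesis by blast
  qed
  ultimately show ?thesis by simp
qed

section \<open>The affine Weyl group\<close>

text \<open>Under the dictionary this is the affine permutation sending \<open>a\<close> to
  \<open>s a - (n+1) * l a\<close>: first a translation, which changes the level by the pairing with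
  \<open>l\<close>, then the permutation \<open>s\<close>.\<close>

definition aff_act :: "nat \<Rightarrow> (nat \<Rightarrow> nat) \<Rightarrow> (nat \<Rightarrow> int) \<Rightarrow> avec \<Rightarrow> avec" where
  "aff_act n s l p = (perm_act s (fst p), snd p + (\<Sum>c\<in>idx n. l c * fst p c))"

lemma aff_act_rt:
  assumes "bij s" "a \<in> idx n" "b \<in> idx n"
  shows "aff_act n s l (rt a b, m) = (rt (s a) (s b), m + l a - l b)"
proof -
  have "(\<Sum>c\<in>idx n. l c * rt a b c)
      = (\<Sum>c\<in>idx n. (if c = a then l c else 0) - (if c = b then l c else 0))"
    by (rule sum.cong) (auto simp: rt_apply)
  then have "(\<Sum>c\<in>idx n. l c * rt a b c) = l a - l b"
    using assms by (simp add: sum_subtractf)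
  then show ?thesis
    using assms by (simp add: aff_act_def perm_act_rt)
qed

lemma aff_act_cong: "(\<And>c. c \<in> idx n \<Longrightarrow> l c = l' c) \<Longrightarrow> aff_act n s l = aff_act n s l'"
  by (auto simp: aff_act_def fun_eq_iff intro!: sum.cong)

lemma aff_act_id: "aff_act n id (\<lambda>c. 0) = id"
  by (auto simp: aff_act_def fun_eq_iff)

lemma aff_act_comp:
  assumes "s permutes idx n" "t permutes idx n"
  shows "aff_act n s l \<circ> aff_act n t l' = aff_act n (s \<circ> t) (\<lambda>c. l' c + l (t c))"
proof
  fix p :: avec
  have "(\<Sum>c\<in>idx n. l c * fst p (inv t c)) = (\<Sum>c\<in>idx n. l (t c) * fst p c)"
    by (subst sum.permute[OF assms(2)]) (simp add: permutes_inverses(2)[OF assms(2)])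
  moreover have "perm_act s (perm_act t (fst p)) = perm_act (s \<circ> t) (fst p)"
    using perm_act_comp[of s t] assms by (metis comp_apply permutes_bij)
  ultimately show "(aff_act n s l \<circ> aff_act n t l') p = aff_act n (s \<circ> t) (\<lambda>c. l' c + l (t c)) p"
    by (simp add: aff_act_def perm_act_def[of t] algebra_simps sum.distrib)
qed

lemma inv_aff_act:
  assumes s: "s permutes idx n"
  shows "bij (aff_act n s l)"
    and "inv (aff_act n s l) = aff_act n (inv s) (\<lambda>c. - l (inv s c))"
proof -
  let ?g = "aff_act n (inv s) (\<lambda>c. - l (inv s c))"
  have "?g \<circ> aff_act n s l = id"
    using s by (simp add: aff_act_comp permutes_inv permutes_inverses permutes_inv_o aff_act_id)
  moreover have "aff_act n s l \<circ> ?g = id"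
    using s by (simp add: aff_act_comp permutes_inv permutes_inverses permutes_inv_o aff_act_id)
  ultimately show "bij (aff_act n s l)" "inv (aff_act n s l) = ?g"
    by (auto intro: o_bij inv_unique_comp)
qed

lemma arefl_alpha:
  assumes "h \<in> {1..n}"
  shows "arefl n (alpha h, 0) = aff_act n (transpose h (Suc h)) (\<lambda>c. 0)"
  using assms by (auto simp: fun_eq_iff alpha_eq_rt arefl_rt idx_iff aff_act_def perm_act_def)

lemma arefl_theta:
  assumes "n \<ge> 1"
  shows "arefl n (- theta n, 1)
    = aff_act n (transpose 1 (Suc n)) (\<lambda>c. of_bool (c = 1) - of_bool (c = Suc n))"
proof
  fix p :: avec
  have "(\<Sum>c\<in>idx n. (of_bool (c = 1) - of_bool (c = Suc n)) * fst p c)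
      = (\<Sum>c\<in>idx n. (if c = 1 then fst p c else 0) - (if c = Suc n then fst p c else 0))"
    by (rule sum.cong) auto
  also have "\<dots> = fst p 1 - fst p (Suc n)"
    by (simp add: sum_subtractf idx_iff)
  finally have "(\<Sum>c\<in>idx n. (of_bool (c = 1) - of_bool (c = Suc n)) * fst p c)
      = fst p 1 - fst p (Suc n)" .
  moreover have "arefl n (rt (Suc n) 1, 1) (fst p, snd p)
      = (fst p \<circ> transpose (Suc n) 1, snd p - (fst p (Suc n) - fst p 1) * 1)"
    by (rule arefl_rt) (auto simp: idx_iff)
  moreover have "- theta n = rt (Suc n) 1"
    using assms by (simp add: theta_eq_rt uminus_rt)
  ultimately show "arefl n (- theta n, 1) p
    = aff_act n (transpose 1 (Suc n)) (\<lambda>c. of_bool (c = 1) - of_bool (c = Suc n)) p"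
    by (simp add: aff_act_def perm_act_def transpose_commute)
qed

text \<open>Sum zero singles out the shifts in the coroot lattice; arbitrary integer shifts would
  give an extended affine group.\<close>

definition aff_perms :: "nat \<Rightarrow> (avec \<Rightarrow> avec) set" where
  "aff_perms n = {aff_act n s l | s l. s permutes idx n \<and> sum l (idx n) = 0}"

lemma aff_perms_comp:
  assumes "v \<in> aff_perms n" "w \<in> aff_perms n"
  shows "v \<circ> w \<in> aff_perms n"
proof -
  obtain s l t l' where v: "v = aff_act n s l" "s permutes idx n" "sum l (idx n) = 0"
    and w: "w = aff_act n t l'" "t permutes idx n" "sum l' (idx n) = 0"
    using assms unfolding aff_perms_def by blast
  have "(\<Sum>c\<in>idx n. l (t c)) = 0"
    using sum.permute[OF w(2), of l] v(3) by (simp add: comp_def)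
  then have "(\<Sum>c\<in>idx n. l' c + l (t c)) = 0"
    using w(3) by (simp add: sum.distrib)
  then show ?thesis
    unfolding aff_perms_def v(1) w(1) aff_act_comp[OF v(2) w(2)]
    using permutes_compose[OF w(2) v(2)] by blast
qed

lemma aff_perms_inv:
  assumes "w \<in> aff_perms n"
  shows "bij w" "inv w \<in> aff_perms n"
proof -
  obtain s l where w: "w = aff_act n s l" "s permutes idx n" "sum l (idx n) = 0"
    using assms unfolding aff_perms_def by blast
  have "(\<Sum>c\<in>idx n. - l (inv s c)) = 0"
    using sum.permute[OF permutes_inv[OF w(2)], of l] w(3) by (simp add: comp_def sum_negf)
  then show "bij w" "inv w \<in> aff_perms n"
    unfolding aff_perms_def w(1) inv_aff_act(2)[OF w(2)]
    using inv_aff_act(1)[OF w(2)] permutes_inv[OF w(2)] by blast+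
qed

lemma arefl_in_aff_perms:
  assumes "n \<ge> 1" "b \<in> aff_simple_roots n"
  shows "arefl n b \<in> aff_perms n"
proof -
  consider h where "h \<in> {1..n}" "b = (alpha h, 0)" | "b = (- theta n, 1)"
    using assms(2) by (auto simp: aff_simple_roots_def simple_roots_def)
  then show ?thesis
  proof cases
    case 1
    then have "arefl n b = aff_act n (transpose h (Suc h)) (\<lambda>c. 0)"
      by (simp add: arefl_alpha)
    moreover have "(\<Sum>c\<in>idx n. 0::int) = 0" by simp
    ultimately show ?thesis
      using transpose_permutes_idx[OF 1(1)] unfolding aff_perms_def by blast
  next
    case 2
    have "transpose 1 (Suc n) permutes idx n"
      by (intro permutes_swap_id) (auto simp: idx_iff)
    moreover have "(\<Sum>c\<in>idx n. of_bool (c = 1) - of_bool (c = Suc n) :: int) = 0"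
      by (simp add: sum_subtractf of_bool_def idx_iff)
    ultimately show ?thesis
      using 2 arefl_theta[OF assms(1)] unfolding aff_perms_def by blast
  qed
qed

lemma aff_weyl_subset:
  assumes "n \<ge> 1"
  shows "aff_weyl n \<subseteq> aff_perms n"
proof
  fix w assume "w \<in> aff_weyl n"
  then show "w \<in> aff_perms n"
  proof (induction rule: aff_weyl.induct)
    case aw_id
    have "id permutes idx n" by (rule permutes_id)
    moreover have "(\<Sum>c\<in>idx n. 0::int) = 0" by simp
    ultimately have "aff_act n id (\<lambda>c. 0) \<in> aff_perms n"
      unfolding aff_perms_def by blast
    then show ?case by (simp only: aff_act_id)
  next
    case (aw_step w b)
    then show ?case
      using aff_perms_comp arefl_in_aff_perms[OF assms] by blast
  qed
qed

lemma aff_weyl_comp: "v \<in> aff_weyl n \<Longrightarrow> w \<in> aff_weyl n \<Longrightarrow> v \<circ> w \<in> aff_weyl n"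
  by (induction rule: aff_weyl.induct) (auto simp: comp_assoc intro: aff_weyl.intros)

lemma arefl_in_aff_weyl: "b \<in> aff_simple_roots n \<Longrightarrow> arefl n b \<in> aff_weyl n"
  using aw_step[OF aw_id] by simp

lemma linear_in_aff_weyl:
  assumes "s permutes idx n"
  shows "aff_act n s (\<lambda>c. 0) \<in> aff_weyl n"
proof -
  obtain hs where hs: "set hs \<subseteq> {1..n}" "perm_act s = wprod n hs"
    using perm_act_is_wprod[OF assms] by blast
  have "(\<lambda>p. (wprod n hs (fst p), snd p)) \<in> aff_weyl n"
    using hs(1)
  proof (induction hs)
    case Nil
    have "(\<lambda>p. (wprod n [] (fst p), snd p)) = id"
      by (simp add: wprod_def fun_eq_iff)
    then show ?case by (rule ssubst) (rule aw_id)
  next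
    case (Cons h hs)
    then have "arefl n (alpha h, 0) \<circ> (\<lambda>p. (wprod n hs (fst p), snd p)) \<in> aff_weyl n"
      by (intro aw_step) (auto simp: aff_simple_roots_def simple_roots_def)
    moreover have "arefl n (alpha h, 0) \<circ> (\<lambda>p. (wprod n hs (fst p), snd p))
        = (\<lambda>p. (wprod n (h # hs) (fst p), snd p))"
      by (simp add: fun_eq_iff arefl_def refl_def wprod_def)
    ultimately show ?case by simp
  qed
  then show ?thesis by (simp add: aff_act_def[abs_def] hs(2))
qed

text \<open>The affine simple reflection times its linear part is, up to sign, the translation by
  the highest root. Conjugating with a permutation reaches every other root.\<close>

lemma root_translation_in_aff_weyl:
  assumes "n \<ge> 1" "a \<in> idx n" "b \<in> idx n" "a \<noteq> b"
  shows "aff_act n id (\<lambda>c. of_bool (c = a) - of_bool (c = b)) \<in> aff_weyl n"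
proof -
  let ?t = "transpose 1 (Suc n)"
  let ?l = "\<lambda>c. of_bool (c = 1) - of_bool (c = Suc n) :: int"
  \<comment> \<open>The conjugating \<open>s\<close> has to send \<open>1\<close> to
    \<open>b\<close> and \<open>Suc n\<close> to \<open>a\<close>. Its outer transposition sends
    \<open>Suc n\<close> to \<open>a\<close>, and \<open>b'\<close> is the point it sends to
    \<open>b\<close>. As \<open>a \<noteq> b\<close>, \<open>b'\<close> differs from
    \<open>Suc n\<close>, so the inner transposition leaves \<open>Suc n\<close> alone.\<close>
  define b' where "b' = transpose (Suc n) a b"
  define s where "s = transpose (Suc n) a \<circ> transpose 1 b'"
  have b': "b' \<in> idx n" "b' \<noteq> Suc n"
    using assms by (auto simp: b'_def transpose_def idx_iff)
  have one: "1 \<in> idx n" "Suc n \<in> idx n" "Suc n \<noteq> 1"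
    using assms by (auto simp: idx_iff)
  have t: "?t permutes idx n"
    using one by (intro permutes_swap_id)
  have s: "s permutes idx n"
    unfolding s_def using one b' assms by (intro permutes_compose permutes_swap_id)
  have s1: "s 1 = b" and sN: "s (Suc n) = a"
    using b'(2) one by (auto simp: s_def b'_def)
  have "aff_act n ?t ?l \<in> aff_weyl n"
    using arefl_in_aff_weyl[of "(- theta n, 1)" n] arefl_theta[OF assms(1)]
    by (simp add: aff_simple_roots_def)
  then have "aff_act n s (\<lambda>c. 0) \<circ> ((aff_act n ?t ?l \<circ> aff_act n ?t (\<lambda>c. 0))
      \<circ> aff_act n (inv s) (\<lambda>c. 0)) \<in> aff_weyl n"
    using s t by (intro aff_weyl_comp linear_in_aff_weyl permutes_inv)
  also have "aff_act n ?t ?l \<circ> aff_act n ?t (\<lambda>c. 0) = aff_act n id (\<lambda>c. ?l (?t c))"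
    using t by (simp add: aff_act_comp del: One_nat_def)
  also have "\<dots> \<circ> aff_act n (inv s) (\<lambda>c. 0) = aff_act n (inv s) (\<lambda>c. ?l (?t (inv s c)))"
    using s by (subst aff_act_comp) (simp_all add: permutes_id permutes_inv del: One_nat_def)
  also have "aff_act n s (\<lambda>c. 0) \<circ> \<dots> = aff_act n id (\<lambda>c. ?l (?t (inv s c)))"
    using s by (subst aff_act_comp) (simp_all add: permutes_inv permutes_inv_o del: One_nat_def)
  also have "\<dots> = aff_act n id (\<lambda>c. of_bool (c = a) - of_bool (c = b))"
  proof (rule aff_act_cong)
    fix c
    have "?t (inv s c) = 1 \<longleftrightarrow> inv s c = Suc n" "?t (inv s c) = Suc n \<longleftrightarrow> inv s c = 1"
      by (auto simp: transpose_def split: if_splits)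
    moreover have "inv s c = d \<longleftrightarrow> c = s d" for d
      using s by (metis permutes_inv_eq)
    ultimately show "?l (?t (inv s c)) = of_bool (c = a) - of_bool (c = b)"
      by (simp only: s1 sN)
  qed
  finally show ?thesis .
qed

text \<open>A nonzero shift of sum zero has a positive and a negative entry; splitting off the root
  vector at these two places lowers the sum of absolute values.\<close>

lemma translation_in_aff_weyl:
  assumes "n \<ge> 1" "sum l (idx n) = 0"
  shows "aff_act n id l \<in> aff_weyl n"
  using assms(2)
proof (induction "nat (\<Sum>c\<in>idx n. \<bar>l c\<bar>)" arbitrary: l rule: less_induct)
  case less
  show ?case
  proof (cases "\<forall>c\<in>idx n. l c = 0")
    case True
    then have "aff_act n id l = id"
      by (subst aff_act_id[of n, symmetric]) (auto intro: aff_act_cong)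
    then show ?thesis using aw_id by simp
  next
    case False
    have "\<exists>a\<in>idx n. l a > 0"
    proof (rule ccontr)
      assume "\<not> (\<exists>a\<in>idx n. l a > 0)"
      then show False
        using False less.prems sum_nonneg_eq_0_iff[of "idx n" "\<lambda>c. - l c"]
        by (force simp: sum_negf not_less)
    qed
    moreover have "\<exists>b\<in>idx n. l b < 0"
    proof (rule ccontr)
      assume "\<not> (\<exists>b\<in>idx n. l b < 0)"
      then show False
        using False less.prems sum_nonneg_eq_0_iff[of "idx n" l]
        by (force simp: not_less)
    qed
    ultimately obtain a b where ab: "a \<in> idx n" "l a > 0" "b \<in> idx n" "l b < 0"
      by blast
    define d where "d c = (of_bool (c = a) - of_bool (c = b) :: int)" for c
    have "sum d (idx n) = 0"
      using ab by (simp add: d_def sum_subtractf of_bool_def)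
    then have "(\<Sum>c\<in>idx n. l c - d c) = 0"
      using less.prems by (simp add: sum_subtractf)
    moreover have "(\<Sum>c\<in>idx n. \<bar>l c - d c\<bar>) < (\<Sum>c\<in>idx n. \<bar>l c\<bar>)"
      by (rule sum_strict_mono_ex1) (use ab in \<open>auto simp: d_def intro!: bexI[of _ a]\<close>)
    moreover from this have "0 < (\<Sum>c\<in>idx n. \<bar>l c\<bar>)"
      by (rule order.strict_trans1[rotated]) (rule sum_nonneg, simp)
    ultimately have "aff_act n id (\<lambda>c. l c - d c) \<in> aff_weyl n"
      by (intro less.hyps) auto
    moreover have "aff_act n id d \<in> aff_weyl n"
      unfolding d_def using ab assms by (intro root_translation_in_aff_weyl) auto
    ultimately have "aff_act n id d \<circ> aff_act n id (\<lambda>c. l c - d c) \<in> aff_weyl n"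
      by (rule aff_weyl_comp[rotated])
    then show ?thesis by (simp add: aff_act_comp permutes_id)
  qed
qed

lemma aff_weyl_eq:
  assumes "n \<ge> 1"
  shows "aff_weyl n = aff_perms n"
proof
  show "aff_perms n \<subseteq> aff_weyl n"
  proof
    fix w assume "w \<in> aff_perms n"
    then obtain s l where w: "w = aff_act n s l" "s permutes idx n" "sum l (idx n) = 0"
      unfolding aff_perms_def by blast
    have "aff_act n s (\<lambda>c. 0) \<circ> aff_act n id l \<in> aff_weyl n"
      using assms w by (intro aff_weyl_comp linear_in_aff_weyl translation_in_aff_weyl)
    then show "w \<in> aff_weyl n"
      using w by (simp add: aff_act_comp permutes_id)
  qed
qed (rule aff_weyl_subset[OF assms])

section \<open>Inversion sets of affine permutations\<close>

lemma rt_in_aff_pos_roots: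
  assumes "a \<in> idx n" "b \<in> idx n" "a \<noteq> b"
  shows "(rt a b, m) \<in> aff_pos_roots n \<longleftrightarrow> 0 < m \<or> m = 0 \<and> a < b"
proof -
  have "rt a b \<in> roots n" using assms by (auto simp: roots_eq)
  then show ?thesis
    using assms by (auto simp: aff_pos_roots_def rt_in_pos_roots)
qed

lemma rt_in_aff_pos_roots_swap:
  assumes "a \<in> idx n" "b \<in> idx n" "a \<noteq> b"
  shows "(rt a b, m) \<in> aff_pos_roots n \<longleftrightarrow> (rt b a, - m) \<notin> aff_pos_roots n"
  using assms by (auto simp: rt_in_aff_pos_roots)

lemma aff_pos_roots_cases:
  assumes "p \<in> aff_pos_roots n"
  obtains a b m where "p = (rt a b, m)" "a \<in> idx n" "b \<in> idx n" "a \<noteq> b"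
proof -
  have "fst p \<in> roots n"
    using assms by (auto simp: aff_pos_roots_def roots_def)
  then show thesis
    using that[of _ _ "snd p"] by (auto simp: roots_eq intro: prod_eqI) (metis prod.collapse)
qed

lemma rt_in_aneg_aff_pos_roots:
  assumes "a \<in> idx n" "b \<in> idx n" "a \<noteq> b"
  shows "(rt a b, m) \<in> aneg ` aff_pos_roots n \<longleftrightarrow> (rt a b, m) \<notin> aff_pos_roots n"
proof -
  have "(rt a b, m) \<in> aneg ` aff_pos_roots n \<longleftrightarrow> (rt b a, - m) \<in> aff_pos_roots n"
  proof
    assume "(rt a b, m) \<in> aneg ` aff_pos_roots n"
    then obtain p where "p \<in> aff_pos_roots n" "(rt a b, m) = aneg p" by blast
    moreover from this have "p = (rt b a, - m)"
      by (auto simp: aneg_def uminus_rt[of a b, symmetric] intro: prod_eqI)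
    ultimately show "(rt b a, - m) \<in> aff_pos_roots n" by simp
  next
    assume "(rt b a, - m) \<in> aff_pos_roots n"
    moreover have "(rt a b, m) = aneg (rt b a, - m)" by (simp add: aneg_def uminus_rt)
    ultimately show "(rt a b, m) \<in> aneg ` aff_pos_roots n" by blast
  qed
  then show ?thesis using assms by (auto simp: rt_in_aff_pos_roots)
qed

lemma rt_in_Ninv:
  assumes inv: "inv w = aff_act n r k" and r: "r permutes idx n"
    and ab: "a \<in> idx n" "b \<in> idx n" "a \<noteq> b"
  shows "(rt a b, m) \<in> Ninv n w \<longleftrightarrow>
    (rt a b, m) \<in> aff_pos_roots n \<and> (rt (r a) (r b), m + k a - k b) \<notin> aff_pos_roots n"
proof -
  have "r a \<in> idx n" "r b \<in> idx n" "r a \<noteq> r b"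
    using r ab by (auto simp: permutes_in_image dest: permutes_inj[THEN injD])
  then show ?thesis
    using ab r by (auto simp: Ninv_def inv aff_act_rt permutes_bij rt_in_aneg_aff_pos_roots)
qed

text \<open>The shift \<open>l\<close> below is weakly decreasing, drops by at most 1 in total, and has sum 0,
  so it vanishes.\<close>

lemma aff_perms_pos_imp_id:
  assumes s: "s permutes idx n" and l: "sum l (idx n) = 0"
    and pos: "\<And>a b m. a \<in> idx n \<Longrightarrow> b \<in> idx n \<Longrightarrow> a \<noteq> b \<Longrightarrow>
      (rt a b, m) \<in> aff_pos_roots n \<Longrightarrow> (rt (s a) (s b), m + l a - l b) \<in> aff_pos_roots n"
  shows "aff_act n s l = id"
proof -
  have pos': "0 < m + l a - l b \<or> m + l a - l b = 0 \<and> s a < s b"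
    if "a \<in> idx n" "b \<in> idx n" "a \<noteq> b" "0 < m \<or> m = 0 \<and> a < b" for a b m
  proof -
    have "s a \<in> idx n" "s b \<in> idx n" "s a \<noteq> s b"
      using s that by (auto simp: permutes_in_image dest: permutes_inj[THEN injD])
    then show ?thesis
      using pos[of a b m] that by (simp add: rt_in_aff_pos_roots)
  qed
  have one: "1 \<in> idx n" "Suc n \<in> idx n" by (auto simp: idx_iff)
  have le1: "l c \<le> l 1" and leN: "l (Suc n) \<le> l c" if "c \<in> idx n" for c
    using pos'[of 1 c 0] pos'[of c "Suc n" 0] that one
    by (cases "c = 1"; cases "c = Suc n"; force simp: idx_iff)+
  \<comment> \<open>Positivity is applied to the affine simple root \<open>(- theta n, 1)\<close>;
    for \<open>n = 0\<close> the two indices coincide.\<close>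
  have step: "l 1 \<le> l (Suc n) + 1"
    using pos'[of "Suc n" 1 1] one by (cases n) auto
  \<comment> \<open>By integrality a negative last value leaves \<open>l 1 \<le> 0\<close>, so in
    either case no two values have opposite signs.\<close>
  have "l c = 0" if "c \<in> idx n" for c
  proof (cases "l (Suc n) \<ge> 0")
    case True
    then have "\<forall>c\<in>idx n. l c = 0"
      using leN l by (subst sum_nonneg_eq_0_iff[symmetric]) force+
    then show ?thesis using that by blast
  next
    case False
    then have "\<forall>c\<in>idx n. - l c = 0"
      using le1 step l by (subst sum_nonneg_eq_0_iff[symmetric]) (force simp: sum_negf)+
    then show ?thesis using that by simp
  qed
  moreover from this have "s h < s (Suc h)" if "h \<in> {1..n}" for h
    using pos'[of h "Suc h" 0] that by (simp add: idx_iff)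
  then have "s = id"
    by (rule increasing_permutes_id[OF s])
  ultimately show ?thesis
    using aff_act_cong[of n l "\<lambda>c. 0" id] by (simp add: aff_act_id)
qed

text \<open>\<open>inv v \<circ> w\<close> keeps positive roots positive. If \<open>w\<close> sends
  a positive root to a positive one, the image lies outside the common inversion set; if to a
  negative one, the opposite of the image lies inside. In both cases \<open>inv v\<close> sends the
  image to a positive root, and an element preserving positivity is the identity.\<close>

lemma Ninv_inj:
  assumes "n \<ge> 1" "v \<in> aff_weyl n" "w \<in> aff_weyl n" "Ninv n v = Ninv n w"
  shows "v = w"
proof -
  have mem: "v \<in> aff_perms n" "w \<in> aff_perms n"
    using assms by (auto simp: aff_weyl_eq)
  obtain r k where r: "inv v = aff_act n r k" "r permutes idx n"
    using aff_perms_inv(2)[OF mem(1)] unfolding aff_perms_def by blast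
  obtain t l where t: "inv w = aff_act n t l" "t permutes idx n"
    using aff_perms_inv(2)[OF mem(2)] unfolding aff_perms_def by blast
  have "inv v \<circ> w \<in> aff_perms n"
    using aff_perms_comp aff_perms_inv(2) mem by blast
  then obtain s j where s: "inv v \<circ> w = aff_act n s j" "s permutes idx n" "sum j (idx n) = 0"
    unfolding aff_perms_def by blast
  have "aff_act n s j = id"
  proof (rule aff_perms_pos_imp_id[OF s(2,3)])
    fix a b m assume ab: "a \<in> idx n" "b \<in> idx n" "a \<noteq> b" "(rt a b, m) \<in> aff_pos_roots n"
    obtain t' l' where w: "w = aff_act n t' l'" "t' permutes idx n"
      using mem(2) unfolding aff_perms_def by blast
    define c d q where "c = t' a" "d = t' b" "q = m + l' a - l' b"
    have cd: "c \<in> idx n" "d \<in> idx n" "c \<noteq> d"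
      using w(2) ab by (auto simp: c_d_q_def permutes_in_image dest: permutes_inj[THEN injD])
    have wab: "w (rt a b, m) = (rt c d, q)"
      using ab w by (simp add: c_d_q_def aff_act_rt permutes_bij)
    then have "inv w (rt c d, q) = (rt a b, m)"
      using aff_perms_inv(1)[OF mem(2)] by (metis bij_inv_eq_iff)
    then have winv: "(rt (t c) (t d), q + l c - l d) = (rt a b, m)"
      using t cd by (simp add: aff_act_rt permutes_bij)
    have vinv: "(rt (s a) (s b), m + j a - j b) = (rt (r c) (r d), q + k c - k d)"
    proof -
      have "inv v (w (rt a b, m)) = aff_act n s j (rt a b, m)"
        using s(1) by (metis comp_apply)
      then show ?thesis
        using wab r s ab cd by (simp add: aff_act_rt permutes_bij)
    qed
    have tcd: "t c \<in> idx n" "t d \<in> idx n" "t c \<noteq> t d" "r c \<in> idx n" "r d \<in> idx n" "r c \<noteq> r d"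
      using t(2) r(2) cd by (auto simp: permutes_in_image dest: permutes_inj[THEN injD])
    have iff: "(rt x y, q') \<in> aff_pos_roots n \<and> (rt (r x) (r y), q' + k x - k y) \<notin> aff_pos_roots n
        \<longleftrightarrow> (rt x y, q') \<in> aff_pos_roots n \<and> (rt (t x) (t y), q' + l x - l y) \<notin> aff_pos_roots n"
      if "x \<in> idx n" "y \<in> idx n" "x \<noteq> y" for x y q'
      using rt_in_Ninv[OF r that] rt_in_Ninv[OF t that] assms(4) by simp
    have tpos: "(rt (t c) (t d), q + l c - l d) \<in> aff_pos_roots n"
      using ab(4) winv by simp
    show "(rt (s a) (s b), m + j a - j b) \<in> aff_pos_roots n"
      unfolding vinv
    proof (cases "(rt c d, q) \<in> aff_pos_roots n")
      case True
      then show "(rt (r c) (r d), q + k c - k d) \<in> aff_pos_roots n"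
        using iff[OF cd, of q] tpos by blast
    next
      case False
      then have "(rt d c, - q) \<in> aff_pos_roots n"
        "(rt (t d) (t c), - q + l d - l c) \<notin> aff_pos_roots n"
        using tpos rt_in_aff_pos_roots_swap[OF cd] rt_in_aff_pos_roots_swap[OF tcd(1-3)]
        by (auto simp: algebra_simps)
      then have "(rt (r d) (r c), - q + k d - k c) \<notin> aff_pos_roots n"
        using iff[OF cd(2,1) cd(3)[symmetric], of "- q"] by blast
      then show "(rt (r c) (r d), q + k c - k d) \<in> aff_pos_roots n"
        using rt_in_aff_pos_roots_swap[OF tcd(4-6)] by (auto simp: algebra_simps)
    qed
  qed
  then have "inv v \<circ> w = id" using s(1) by simp
  then have "v \<circ> (inv v \<circ> w) = v" by simp
  then show ?thesis
    using aff_perms_inv(1)[OF mem(1)] by (simp add: fun_eq_iff bij_is_surj surj_f_inv_f)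
qed

section \<open>Affine permutations given by a window\<close>

lemma eq_of_eq_add_mult:
  fixes x y N z :: int
  assumes "x = y + N * z" "\<bar>x - y\<bar> < N"
  shows "z = 0"
proof -
  have "N dvd x - y" using assms by simp
  then have "x - y = 0"
    using assms(2) by (meson dvd_abs_iff not_less zdvd_imp_le zero_less_abs_iff)
  then show ?thesis using assms by auto
qed

text \<open>Pairwise incongruent values reduce to a permutation of the residues, and the negated
  quotients are the shift. As the residues sum to the same total as \<open>idx n\<close>, the
  condition on \<open>u\<close> forces the shift to sum to zero.\<close>

lemma affine_perm_of_window:
  fixes u :: "nat \<Rightarrow> int"
  assumes inj: "\<And>a b. a \<in> idx n \<Longrightarrow> b \<in> idx n \<Longrightarrow> a < b \<Longrightarrow> \<not> int (Suc n) dvd u b - u a"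
    and sum: "(\<Sum>c\<in>idx n. u c) = (\<Sum>c\<in>idx n. int c)"
  obtains r k where "r permutes idx n" "sum k (idx n) = 0"
    "\<And>c. c \<in> idx n \<Longrightarrow> int (r c) = u c + int (Suc n) * k c"
proof -
  define N where "N = int (Suc n)"
  have N: "N > 0" by (simp add: N_def)
  \<comment> \<open>Residues are represented by \<open>1\<close> to \<open>n+1\<close> instead of
    \<open>0\<close> to \<open>n\<close>, hence the subtraction of 1 before \<open>mod\<close> and
    the \<open>Suc\<close> after it.\<close>
  define r where "r c = (if c \<in> idx n then Suc (nat ((u c - 1) mod N)) else c)" for c
  define k where "k c = - ((u c - 1) div N)" for c
  have rk: "int (r c) = u c + N * k c" if "c \<in> idx n" for c
  proof -
    have "int (r c) = (u c - 1) mod N + 1" using that N by (simp add: r_def)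
    then show ?thesis by (simp add: k_def minus_div_mult_eq_mod[symmetric] algebra_simps)
  qed
  have "r c \<in> idx n" if "c \<in> idx n" for c
  proof -
    have "(u c - 1) mod N < N" "0 \<le> (u c - 1) mod N" using N by simp_all
    then have "(u c - 1) mod N \<le> int n" unfolding N_def by linarith
    then have "nat ((u c - 1) mod N) \<le> n" by (simp add: nat_le_iff)
    then show ?thesis using that by (simp add: r_def idx_iff)
  qed
  moreover have "inj_on r (idx n)"
  proof (rule linorder_inj_onI')
    fix a b assume ab: "a \<in> idx n" "b \<in> idx n" "a < b"
    show "r a \<noteq> r b"
    proof
      assume "r a = r b"
      then have "u b - u a = N * (k a - k b)"
        using rk[OF ab(1)] rk[OF ab(2)] by (simp add: algebra_simps)
      then show False using inj[OF ab] by (simp add: N_def)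
    qed
  qed
  ultimately have bij: "bij_betw r (idx n) (idx n)"
    by (simp add: bij_betw_def endo_inj_surj image_subset_iff)
  then have r: "r permutes idx n"
    by (rule bij_imp_permutes) (simp add: r_def)
  have "(\<Sum>c\<in>idx n. int (r c)) = (\<Sum>c\<in>idx n. int c)"
    using sum.reindex_bij_betw[OF bij, of int] .
  moreover have "(\<Sum>c\<in>idx n. int (r c)) = (\<Sum>c\<in>idx n. u c) + N * sum k (idx n)"
    by (simp add: rk sum.distrib sum_distrib_left cong: sum.cong)
  ultimately have "sum k (idx n) = 0"
    using sum N by simp
  then show thesis
    using that[OF r] rk by (simp add: N_def)
qed

text \<open>The image root stands for the integers \<open>u a\<close> and
  \<open>u b + (n+1) * m\<close>. Since \<open>r a\<close> and \<open>r b\<close> differ by less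
  than \<open>n+1\<close>, the level decides the comparison and the residues only break ties, just
  as in \<open>aff_pos_roots\<close>.\<close>

lemma window_pos_iff:
  fixes u :: "nat \<Rightarrow> int"
  assumes r: "r permutes idx n"
    and rk: "\<And>c. c \<in> idx n \<Longrightarrow> int (r c) = u c + int (Suc n) * k c"
    and ab: "a \<in> idx n" "b \<in> idx n" "a \<noteq> b"
  shows "(rt (r a) (r b), m + k a - k b) \<in> aff_pos_roots n \<longleftrightarrow> u a < u b + int (Suc n) * m"
proof -
  define N D where "N = int (Suc n)" "D = m + k a - k b"
  have rr: "r a \<in> idx n" "r b \<in> idx n" "r a \<noteq> r b"
    using r ab by (auto simp: permutes_in_image dest: permutes_inj[THEN injD])
  have bound: "\<bar>int (r b) - int (r a)\<bar> < N"
    using rr by (auto simp: N_D_def idx_iff)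
  have eq: "u b + N * m - u a = int (r b) - int (r a) + N * D"
    using rk[OF ab(1)] rk[OF ab(2)] by (simp add: N_D_def algebra_simps)
  consider "D \<ge> 1" | "D = 0" | "D \<le> -1" by linarith
  then have "0 < D \<or> D = 0 \<and> r a < r b \<longleftrightarrow> 0 < int (r b) - int (r a) + N * D"
  proof cases
    case 1
    then have "N * D \<ge> N * 1" using bound by (intro mult_left_mono) auto
    then show ?thesis using 1 bound by linarith
  next
    case 3
    then have "N * D \<le> N * (-1)" using bound by (intro mult_left_mono) auto
    then show ?thesis using 3 bound by linarith
  qed auto
  then show ?thesis
    using rr eq by (auto simp: rt_in_aff_pos_roots N_D_def)
qed

section \<open>Abelian ideals\<close>

lemma abelian_ideal_subset: "abelian_ideal n I \<Longrightarrow> I \<subseteq> pos_roots n"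
  by (simp add: abelian_ideal_def)

lemma abelian_ideal_upward:
  assumes "abelian_ideal n I" "rt a b \<in> I" "c \<le> a" "b \<le> d" "c \<in> idx n" "d \<in> idx n"
  shows "rt c d \<in> I"
proof -
  have ab: "rt a b \<in> pos_roots n"
    using assms by (auto simp: abelian_ideal_def)
  then have "c < d" using rt_pos_rootsD(1)[OF ab] assms by simp
  then have cd: "rt c d \<in> pos_roots n"
    using assms by (simp add: rt_in_pos_roots)
  then have "root_ge n (rt c d) (rt a b)"
    using ab assms by (simp add: root_ge_rt)
  then show ?thesis
    using assms(1,2) cd unfolding abelian_ideal_def by blast
qed

lemma abelian_ideal_no_chain:
  assumes "abelian_ideal n I" "rt a b \<in> I" "rt b c \<in> I"
  shows False
proof -
  have "rt a b \<in> pos_roots n" "rt b c \<in> pos_roots n"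
    using assms by (auto simp: abelian_ideal_def)
  from this[THEN rt_pos_rootsD(1)] this[THEN rt_pos_rootsD(2)] this[THEN rt_pos_rootsD(3)]
  have "rt a c \<in> roots n"
    unfolding roots_eq by fastforce
  moreover have "rt a b + rt b c = rt a c" by (simp add: rt_def)
  ultimately show False
    using assms unfolding abelian_ideal_def by metis
qed

section \<open>The window of an abelian ideal\<close>

definition row :: "nat \<Rightarrow> vec set \<Rightarrow> nat \<Rightarrow> nat set" where
  "row n I a = {b \<in> idx n. rt a b \<in> I}"

definition col :: "nat \<Rightarrow> vec set \<Rightarrow> nat \<Rightarrow> nat set" where
  "col n I b = {a \<in> idx n. rt a b \<in> I}"

text \<open>The window of the affine permutation \<open>w\<^sub>I\<^sup>-\<^sup>1\<close>: the value at \<open>c\<close> is shifted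
  by the inversions in \<open>N(w\<^sub>I)\<close> that involve \<open>c\<close>.\<close>

definition window :: "nat \<Rightarrow> vec set \<Rightarrow> nat \<Rightarrow> int" where
  "window n I c = int c + int (card (col n I c)) - int (card (row n I c))"

lemma finite_row_col [simp]: "finite (row n I a)" "finite (col n I a)"
  by (simp_all add: row_def col_def)

lemma row_subset: "I \<subseteq> pos_roots n \<Longrightarrow> row n I a \<subseteq> {Suc a..Suc n}"
  by (auto simp: row_def idx_iff dest!: subsetD[THEN rt_pos_rootsD(1)])

lemma col_subset: "I \<subseteq> pos_roots n \<Longrightarrow> col n I b \<subseteq> {1..<b}"
  by (auto simp: col_def idx_iff dest!: subsetD[THEN rt_pos_rootsD(1)])

text \<open>Double counting: a cell \<open>(a, b)\<close> adds 1 at \<open>b\<close> and subtracts 1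
  at \<open>a\<close>.\<close>

lemma sum_window: "(\<Sum>c\<in>idx n. window n I c) = (\<Sum>c\<in>idx n. int c)"
proof -
  have *: "card {x \<in> idx n. P x} = (\<Sum>x\<in>idx n. if P x then 1 else 0)" for P
    by (simp add: sum.If_cases Collect_conj_eq)
  have "(\<Sum>c\<in>idx n. card (col n I c)) = (\<Sum>c\<in>idx n. card (row n I c))"
    unfolding row_def col_def * by (rule sum.swap)
  then have "(\<Sum>c\<in>idx n. int (card (col n I c))) = (\<Sum>c\<in>idx n. int (card (row n I c)))"
    by (simp flip: of_nat_sum)
  then show ?thesis
    by (simp add: window_def sum.distrib sum_subtractf)
qed

text \<open>Together the four bounds describe all inversions of the window: none at level 0, exactly
  the ideal at level 1, none from level 2 on. The first holds because rows shrink and columns grow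
  along an upward closed set.\<close>

lemma window_ideal:
  assumes I: "abelian_ideal n I" and ab: "a \<in> idx n" "b \<in> idx n" "a < b"
  shows "window n I a < window n I b"
    and "rt a b \<in> I \<Longrightarrow> window n I a + int (Suc n) < window n I b"
    and "rt a b \<notin> I \<Longrightarrow> window n I b < window n I a + int (Suc n)"
    and "window n I b < window n I a + 2 * int (Suc n)"
proof -
  note sub = abelian_ideal_subset[OF I]
  note up = abelian_ideal_upward[OF I]
  have "row n I b \<subseteq> row n I a" "col n I a \<subseteq> col n I b"
    using ab by (auto simp: row_def col_def intro: up)
  then have "card (row n I b) \<le> card (row n I a)" "card (col n I a) \<le> card (col n I b)"
    by (auto intro: card_mono)
  then show "window n I a < window n I b"
    using ab by (simp add: window_def)
  show "window n I a + int (Suc n) < window n I b" if "rt a b \<in> I"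
  proof -
    \<comment> \<open>A cell in row \<open>b\<close> or column \<open>a\<close> would form a chain
      with \<open>(a, b)\<close>. Upward closure fills the rest, so the gap is at least
      \<open>(b - a) + a + (n + 2 - b) = n + 2\<close>.\<close>
    have "row n I b = {}" "col n I a = {}"
      using that abelian_ideal_no_chain[OF I] by (auto simp: row_def col_def)
    moreover have "{b..Suc n} \<subseteq> row n I a" "{1..a} \<subseteq> col n I b"
      using ab that by (auto simp: row_def col_def idx_iff intro: up)
    from this[THEN card_mono[rotated]] have "Suc (Suc n) - b \<le> card (row n I a)" "a \<le> card (col n I b)"
      by auto
    ultimately show ?thesis
      using ab by (simp add: window_def idx_iff)
  qed
  show "window n I b < window n I a + int (Suc n)" if "rt a b \<notin> I"
  proof -
    \<comment> \<open>Row \<open>a\<close> starts beyond \<open>b\<close> and column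
      \<open>b\<close> ends before \<open>a\<close>, so the gap is at most
      \<open>(b - a) + (a - 1) + (n + 1 - b) = n\<close>.\<close>
    have "row n I a \<subseteq> {Suc b..Suc n}" "col n I b \<subseteq> {1..<a}"
      using that ab by (auto simp: row_def col_def idx_iff not_less_eq_eq intro: up)
    from this[THEN card_mono[rotated]] have "card (row n I a) \<le> Suc n - b" "card (col n I b) \<le> a - 1"
      by auto
    then show ?thesis
      using ab by (simp add: window_def idx_iff)
  qed
  \<comment> \<open>A common \<open>c\<close> would give the chain \<open>(a, c)\<close>,
    \<open>(c, b)\<close>. Hence the two sizes add up to at most \<open>n+1\<close>, while
    \<open>b - a \<le> n\<close>.\<close>
  have "row n I a \<inter> col n I b = {}"
    using abelian_ideal_no_chain[OF I] by (auto simp: row_def col_def)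
  then have "card (row n I a) + card (col n I b) = card (row n I a \<union> col n I b)"
    by (simp add: card_Un_disjoint)
  also have "\<dots> \<le> card (idx n)"
    by (rule card_mono) (auto simp: row_def col_def)
  finally show "window n I b < window n I a + 2 * int (Suc n)"
    using ab by (simp add: window_def idx_iff)
qed

text \<open>Gaps lie strictly between 0 and \<open>2 * (n+1)\<close> and never equal
  \<open>n+1\<close>, so the window defines an affine permutation. Its inverse has the prescribed
  inversion set, and \<open>Ninv_inj\<close> identifies it with \<open>wI n I\<close>.\<close>

lemma wI_window:
  assumes n: "n \<ge> 1" and I: "abelian_ideal n I"
  obtains r k where "r permutes idx n"
    "\<And>c. c \<in> idx n \<Longrightarrow> int (r c) = window n I c + int (Suc n) * k c"
    "inv (wI n I) = aff_act n r k"
proof -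
  have "\<not> int (Suc n) dvd window n I b - window n I a"
    if ab: "a \<in> idx n" "b \<in> idx n" "a < b" for a b
  proof
    assume "int (Suc n) dvd window n I b - window n I a"
    then obtain q where q: "window n I b - window n I a = int (Suc n) * q" ..
    then have "0 < int (Suc n) * q" "int (Suc n) * q < int (Suc n) * 2"
      using window_ideal(1,4)[OF I ab] by simp_all
    then have "0 < q" "q < 2"
      by (simp_all only: zero_less_mult_iff mult_less_cancel_left) auto
    then have "q = 1" by simp
    then show False
      using q window_ideal(2,3)[OF I ab] by (cases "rt a b \<in> I") auto
  qed
  from affine_perm_of_window[OF this sum_window]
  obtain r k where r: "r permutes idx n" "sum k (idx n) = 0"
    and rk: "\<And>c. c \<in> idx n \<Longrightarrow> int (r c) = window n I c + int (Suc n) * k c" by blast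
  define w where "w = inv (aff_act n r k)"
  have act: "aff_act n r k \<in> aff_perms n"
    using r unfolding aff_perms_def by blast
  have w: "w \<in> aff_weyl n"
    unfolding aff_weyl_eq[OF n] w_def using aff_perms_inv(2)[OF act] .
  have winv: "inv w = aff_act n r k"
    unfolding w_def using aff_perms_inv(1)[OF act] by (rule inv_inv_eq)
  have mem: "(rt a b, m) \<in> Ninv n w \<longleftrightarrow> m = 1 \<and> rt b a \<in> I"
    if ab: "a \<in> idx n" "b \<in> idx n" "a \<noteq> b" for a b m
  proof -
    have *: "(rt a b, m) \<in> Ninv n w \<longleftrightarrow>
        (0 < m \<or> m = 0 \<and> a < b) \<and> \<not> window n I a < window n I b + int (Suc n) * m"
      using window_pos_iff[where u = "window n I", OF r(1) _ ab, of k m] rk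
      by (simp add: rt_in_Ninv[OF winv r(1) ab] rt_in_aff_pos_roots[OF ab] del: of_nat_Suc)
    show ?thesis
    proof (cases "a < b")
      case True
      then have "rt b a \<notin> I"
        using abelian_ideal_subset[OF I] rt_pos_rootsD(1)[of b a n] by auto
      moreover have "window n I a < window n I b + int (Suc n) * m" if "m \<ge> 0"
        using window_ideal(1)[OF I ab(1,2) True] mult_nonneg_nonneg[of "int (Suc n)" m] that
        by linarith
      ultimately show ?thesis using * by auto
    next
      case False
      then have ba: "b < a" using ab by simp
      note win = window_ideal[OF I ab(2,1) ba]
      consider "m \<le> 0" | "m = 1" | "m \<ge> 2" by linarith
      then show ?thesis
      proof cases
        case 2
        then show ?thesis using * win(2,3) by (cases "rt b a \<in> I") auto
      next
        case 3
        then have "int (Suc n) * 2 \<le> int (Suc n) * m" by (intro mult_left_mono) auto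
        then have "window n I a < window n I b + int (Suc n) * m" using win(4) by linarith
        then show ?thesis using * 3 by simp
      qed (use * ba in auto)
    qed
  qed
  have "Ninv n w = {(- b, 1) | b. b \<in> I}"
  proof (intro equalityI subsetI)
    fix p assume p: "p \<in> Ninv n w"
    then have "p \<in> aff_pos_roots n" by (simp add: Ninv_def)
    then obtain a b m where "p = (rt a b, m)" "a \<in> idx n" "b \<in> idx n" "a \<noteq> b"
      by (rule aff_pos_roots_cases)
    then show "p \<in> {(- b, 1) | b. b \<in> I}"
      using p mem by (auto simp: uminus_rt intro!: exI[of _ "rt b a"])
  next
    fix p assume "p \<in> {(- b, 1 :: int) | b. b \<in> I}"
    then obtain x where x: "p = (- x, 1)" "x \<in> I" by blast
    then obtain a b where "x = rt a b" "a \<in> idx n" "b \<in> idx n" "a < b"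
      using abelian_ideal_subset[OF I] by (auto simp: pos_roots_eq)
    then show "p \<in> Ninv n w"
      using x mem[of b a 1] by (simp add: uminus_rt)
  qed
  then have "wI n I = w"
    unfolding wI_def using w Ninv_inj[OF n] by (intro the_equality) auto
  then show thesis
    using that[OF r(1) rk] winv by simp
qed

text \<open>Only the window values at \<open>1\<close> and \<open>Suc n\<close> matter: they ask for
  \<open>i\<close> cells in column \<open>n+1\<close> and \<open>n+1-i\<close> cells in row 1.
  Upward closure turns these sizes into the presence of the two cells, and abelianness gives the
  matching upper bounds for the converse.\<close>

lemma Iab_iff:
  assumes n: "n \<ge> 1" and i: "i \<in> {1..n}"
  shows "I \<in> Iab n (alpha i) \<longleftrightarrow>
    abelian_ideal n I \<and> rt 1 (Suc i) \<in> I \<and> rt i (Suc n) \<in> I"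
proof (cases "abelian_ideal n I")
  case I: True
  note sub = abelian_ideal_subset[OF I]
  obtain r k where r: "r permutes idx n" and inv: "inv (wI n I) = aff_act n r k"
    and rk: "\<And>c. c \<in> idx n \<Longrightarrow> int (r c) = window n I c + int (Suc n) * k c"
    using wI_window[OF n I] by metis
  have one: "1 \<in> idx n" "Suc n \<in> idx n" "Suc n \<noteq> 1"
    using n by (auto simp: idx_iff)
  have "- theta n = rt (Suc n) 1"
    using n by (simp add: theta_eq_rt uminus_rt)
  then have "inv (wI n I) (- theta n, 2) = (rt (r (Suc n)) (r 1), 2 + k (Suc n) - k 1)"
    using one r by (simp add: inv aff_act_rt permutes_bij)
  moreover have "r (Suc n) \<noteq> r 1"
    using r one by (auto dest: permutes_inj[THEN injD])
  ultimately have iff: "I \<in> Iab n (alpha i) \<longleftrightarrow> r (Suc n) = i \<and> r 1 = Suc i \<and> 2 + k (Suc n) = k 1"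
    using I by (auto simp: Iab_def alpha_eq_rt rt_eq_iff)
  have "col n I 1 = {}" "row n I (Suc n) = {}"
    using col_subset[OF sub, of 1] row_subset[OF sub, of "Suc n"] by auto
  then have r1: "int (r 1) = 1 - int (card (row n I 1)) + int (Suc n) * k 1"
    and rN: "int (r (Suc n)) = int (Suc n) + int (card (col n I (Suc n))) + int (Suc n) * k (Suc n)"
    using rk[OF one(1)] rk[OF one(2)] by (simp_all add: window_def)
  have "row n I 1 \<subseteq> {2..Suc n}" "col n I (Suc n) \<subseteq> {1..n}"
    using row_subset[OF sub, of 1] col_subset[OF sub, of "Suc n"] by auto
  from this[THEN card_mono[rotated]]
  have le: "card (row n I 1) \<le> n" "card (col n I (Suc n)) \<le> n" by simp_all
  have "r 1 \<in> idx n" "r (Suc n) \<in> idx n"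
    using one permutes_in_image[OF r] by auto
  then have rbound: "1 \<le> r 1" "r 1 \<le> Suc n" "1 \<le> r (Suc n)" "r (Suc n) \<le> Suc n"
    by (auto simp: idx_iff)
  show ?thesis
  proof
    assume "I \<in> Iab n (alpha i)"
    then have ri: "r (Suc n) = i" "r 1 = Suc i" "k 1 = k (Suc n) + 2"
      using iff by auto
    have "int i = int (card (col n I (Suc n))) + int (Suc n) * (1 + k (Suc n))"
      using rN ri by (simp add: algebra_simps)
    \<comment> \<open>Both \<open>i\<close> and the column size lie between 0 and \<open>n\<close>,
      so congruence modulo \<open>n+1\<close> is equality.\<close>
    moreover from this have "1 + k (Suc n) = 0"
      by (rule eq_of_eq_add_mult) (use le i in auto)
    ultimately have col: "card (col n I (Suc n)) = i" and "k (Suc n) = -1"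
      by (auto simp: algebra_simps)
    then have row: "card (row n I 1) = Suc n - i"
      using r1 ri i by simp
    \<comment> \<open>Column \<open>n+1\<close> is an initial segment of the rows; without row
      \<open>i\<close> it would have fewer than \<open>i\<close> cells. Row 1 is a final segment and
      is treated alike.\<close>
    have "rt i (Suc n) \<in> I"
    proof (rule ccontr)
      assume "rt i (Suc n) \<notin> I"
      then have "col n I (Suc n) \<subseteq> {1..<i}"
        using abelian_ideal_upward[OF I, of _ "Suc n" i "Suc n"] one i
        by (force simp: col_def idx_iff not_less)
      then show False
        using card_mono[of "{1..<i}" "col n I (Suc n)"] col i by auto
    qed
    moreover have "rt 1 (Suc i) \<in> I"
    proof (rule ccontr)
      assume "rt 1 (Suc i) \<notin> I"
      then have "row n I 1 \<subseteq> {Suc (Suc i)..Suc n}"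
        using abelian_ideal_upward[OF I, of 1 _ 1 "Suc i"] one i
        by (force simp: row_def idx_iff not_less_eq_eq)
      then show False
        using card_mono[of "{Suc (Suc i)..Suc n}" "row n I 1"] row i by auto
    qed
    ultimately show "abelian_ideal n I \<and> rt 1 (Suc i) \<in> I \<and> rt i (Suc n) \<in> I"
      using I by blast
  next
    assume A: "abelian_ideal n I \<and> rt 1 (Suc i) \<in> I \<and> rt i (Suc n) \<in> I"
    \<comment> \<open>A lower cell in this column would bring \<open>(i+1, n+1)\<close> into the
      ideal, which forms a chain with \<open>(1, i+1)\<close>.\<close>
    have "a \<le> i" if "rt a (Suc n) \<in> I" for a
    proof (rule ccontr)
      assume "\<not> a \<le> i"
      then have "rt (Suc i) (Suc n) \<in> I"
        using abelian_ideal_upward[OF I that, of "Suc i" "Suc n"] one i by (auto simp: idx_iff)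
      then show False using A abelian_ideal_no_chain[OF I] by blast
    qed
    then have "col n I (Suc n) = {1..i}"
      using A abelian_ideal_upward[OF I, of i "Suc n" _ "Suc n"] i one
      by (auto simp: col_def idx_iff)
    moreover have "Suc i \<le> b" if "rt 1 b \<in> I" for b
    proof (rule ccontr)
      assume "\<not> Suc i \<le> b"
      then have "rt 1 i \<in> I"
        using abelian_ideal_upward[OF I that, of 1 i] one i by (auto simp: idx_iff)
      then show False using A abelian_ideal_no_chain[OF I] by blast
    qed
    then have "row n I 1 = {Suc i..Suc n}"
      using A abelian_ideal_upward[OF I, of 1 "Suc i" 1] i one
      by (auto simp: row_def idx_iff)
    ultimately have "int (r (Suc n)) = int i + int (Suc n) * (1 + k (Suc n))"
      and "int (r 1) = int (Suc i) + int (Suc n) * (k 1 - 1)"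
      using rN r1 i by (simp_all add: algebra_simps of_nat_diff)
    moreover from this(1) have "1 + k (Suc n) = 0"
      by (rule eq_of_eq_add_mult) (use rbound i in auto)
    moreover from calculation(2) have "k 1 - 1 = 0"
      by (rule eq_of_eq_add_mult) (use rbound i in auto)
    ultimately show "I \<in> Iab n (alpha i)"
      using iff by simp
  qed
qed (simp add: Iab_def)

section \<open>Borders\<close>

lemma rt_minus_simple_pos:
  assumes "a < b" "rt a b - rt h (Suc h) \<in> pos_roots n"
  shows "Suc a < b" "h = a \<or> Suc h = b"
proof -
  obtain c d where cd: "rt a b - rt h (Suc h) = rt c d" "c < d"
    using assms(2) by (auto simp: pos_roots_eq)
  have *: "rt a b k - rt h (Suc h) k = rt c d k" for k
    using cd(1) by (metis minus_apply)
  show h: "h = a \<or> Suc h = b"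
    using *[of h] *[of "Suc h"] cd(2) assms(1) by (auto simp: rt_apply split: if_splits)
  show "Suc a < b"
  proof (rule ccontr)
    assume "\<not> Suc a < b"
    then have "b = Suc a" "h = a" using h assms(1) by auto
    then show False using *[of c] cd(2) by (simp add: rt_apply)
  qed
qed

text \<open>Only the simple roots at the two ends of \<open>rt a b\<close> can be subtracted, and
  subtracting the same one twice leaves an entry 2 or -2. So the border condition concerns just the
  next cell on the antidiagonal.\<close>

lemma border_iff:
  assumes I: "I \<subseteq> pos_roots n"
  shows "rt a b \<in> border n I \<longleftrightarrow> rt a b \<in> I \<and> rt (Suc a) (b - 1) \<notin> I"
proof (cases "rt a b \<in> I")
  case True
  then have ab: "a < b" "a \<in> idx n" "b \<in> idx n"
    using rt_pos_rootsD[of a b n] I by blast+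
  have two: "rt a b - rt a (Suc a) - rt (b - 1) b = rt (Suc a) (b - 1)"
    by (simp add: rt_def)
  show ?thesis
  proof
    assume B: "rt a b \<in> border n I"
    have "rt (Suc a) (b - 1) \<notin> I"
    proof
      assume J: "rt (Suc a) (b - 1) \<in> I"
      then have less: "Suc a < b - 1"
        using rt_pos_rootsD(1)[of "Suc a" "b - 1" n] I by blast
      have "rt a (Suc a) \<in> simple_roots n" "rt (b - 1) (Suc (b - 1)) \<in> simple_roots n"
        using ab less unfolding simple_roots_eq idx_iff
        by (force, intro CollectI exI[of _ "b - 1"], auto)
      then have "rt a (Suc a) \<in> simple_roots n" "rt (b - 1) b \<in> simple_roots n"
        using ab by simp_all
      moreover have "rt a b - rt a (Suc a) = rt (Suc a) b" "rt a b - rt (b - 1) b = rt a (b - 1)"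
        by (simp_all add: rt_def)
      moreover have "rt (Suc a) b \<in> pos_roots n" "rt a (b - 1) \<in> pos_roots n"
        using ab less by (auto simp: rt_in_pos_roots idx_iff)
      ultimately have "rt a b - rt a (Suc a) - rt (b - 1) b \<notin> I"
        using B unfolding border_def by force
      then show False using J two by simp
    qed
    then show "rt a b \<in> I \<and> rt (Suc a) (b - 1) \<notin> I" using True by simp
  next
    assume nI: "rt a b \<in> I \<and> rt (Suc a) (b - 1) \<notin> I"
    show "rt a b \<in> border n I"
      unfolding border_def mem_Collect_eq
    proof (intro conjI ballI impI True)
      fix g h assume "g \<in> simple_roots n" "h \<in> simple_roots n"
      then obtain p q where g: "g = rt p (Suc p)" and h: "h = rt q (Suc q)"
        by (auto simp: simple_roots_eq)
      assume "rt a b - g \<in> pos_roots n \<and> rt a b - h \<in> pos_roots n"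
      then have ab': "Suc a < b" and p: "p = a \<or> Suc p = b" and q: "q = a \<or> Suc q = b"
        using rt_minus_simple_pos[OF ab(1)] g h by blast+
      show "rt a b - g - h \<notin> I"
      proof (cases "p = q")
        case True
        have "rt a b - g - h \<notin> pos_roots n"
        proof
          assume "rt a b - g - h \<in> pos_roots n"
          then obtain c d where "rt a b - g - h = rt c d"
            by (auto simp: pos_roots_eq)
          then have *: "rt a b k - rt p (Suc p) k - rt p (Suc p) k = rt c d k" for k
            unfolding g h True by (metis minus_apply)
          have bound: "rt c d k \<le> 1" "-1 \<le> rt c d k" for k
            by (auto simp: rt_apply)
          show False
          proof (cases "p = a")
            case True
            then have "rt a b (Suc a) - rt p (Suc p) (Suc a) - rt p (Suc p) (Suc a) = 2"
              using ab' by (simp add: rt_apply)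
            then show False using *[of "Suc a"] bound(1)[of "Suc a"] by simp
          next
            case False
            then have "rt a b p - rt p (Suc p) p - rt p (Suc p) p = - 2"
              using p by (auto simp: rt_apply)
            then show False using *[of p] bound(2)[of p] by simp
          qed
        qed
        then show ?thesis using I by blast
      next
        case False
        then have "p = a \<and> q = b - 1 \<or> p = b - 1 \<and> q = a" "Suc (b - 1) = b"
          using p q ab' by auto
        then have "rt a b - g - h = rt (Suc a) (b - 1)"
          unfolding g h by (auto simp: rt_def)
        then show ?thesis using nI by simp
      qed
    qed
  qed
qed (auto simp: border_def)

text \<open>The cardinality \<open>n = i + (n+1-i) - 1\<close> is the number of values of
  \<open>a + b\<close> on the rectangle. By monotonicity distinct cells have distinct sums, so each
  value occurs once, as on a lattice path. The clauses mirror \<open>anti_standard\<close>, with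
  rows as sources and columns as targets.\<close>

definition staircase :: "nat \<Rightarrow> nat \<Rightarrow> (nat \<times> nat) set \<Rightarrow> bool" where
  "staircase n i B \<longleftrightarrow> B \<subseteq> {1..i} \<times> {Suc i..Suc n} \<and> card B = n
     \<and> (\<forall>a\<in>{1..i}. \<exists>b. (a, b) \<in> B) \<and> (\<forall>b\<in>{Suc i..Suc n}. \<exists>a. (a, b) \<in> B)
     \<and> (\<forall>a b a' b'. (a, b) \<in> B \<longrightarrow> (a', b') \<in> B \<longrightarrow> a < a' \<longrightarrow> b \<le> b')"

lemma greatest_with:
  fixes P :: "nat \<Rightarrow> bool"
  assumes "P a" "\<And>x. P x \<Longrightarrow> x \<le> m"
  obtains x where "P x" "\<not> P (Suc x)"
proof -
  have "P (GREATEST x. P x)" by (rule GreatestI_nat) (use assms in auto)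
  moreover have "\<not> P (Suc (GREATEST x. P x))"
    using Greatest_le_nat[of P "Suc (GREATEST x. P x)" m] assms(2) by force
  ultimately show thesis using that by blast
qed

text \<open>Every antidiagonal \<open>a + b = d\<close> that meets the rectangle contains exactly one cell of
  the border, namely its last cell inside the ideal.\<close>

lemma staircase_border:
  assumes i: "i \<in> {1..n}" and I: "abelian_ideal n I"
    and corners: "rt 1 (Suc i) \<in> I" "rt i (Suc n) \<in> I"
  shows "staircase n i {(a, b). rt a b \<in> border n I}"
proof -
  let ?J = "{(a, b). rt a b \<in> border n I}"
  note sub = abelian_ideal_subset[OF I]
  note up = abelian_ideal_upward[OF I]
  note chain = abelian_ideal_no_chain[OF I]
  note border = border_iff[OF sub]
  have idx: "a \<in> idx n" "b \<in> idx n" "a < b" if "rt a b \<in> I" for a b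
    using that sub rt_pos_rootsD[of a b n] by blast+
  have le: "a \<le> i" if ab: "rt a b \<in> I" for a b
  proof (rule ccontr)
    assume "\<not> a \<le> i"
    then have "rt (Suc i) (Suc n) \<in> I"
      using up[OF ab, of "Suc i" "Suc n"] idx[OF ab] by (auto simp: idx_iff)
    then show False using corners chain by blast
  qed
  have gt: "i < b" if ab: "rt a b \<in> I" for a b
  proof (rule ccontr)
    assume "\<not> i < b"
    then have "rt 1 i \<in> I"
      using up[OF ab, of 1 i] idx[OF ab] i by (auto simp: idx_iff)
    then show False using corners chain by blast
  qed
  \<comment> \<open>If \<open>b > b'\<close>, then \<open>(a+1, b-1)\<close> still dominates
    \<open>(a', b')\<close> and lies in the ideal, against the border condition for
    \<open>(a, b)\<close>.\<close>
  have mono: "b \<le> b'" if "rt a b \<in> border n I" "rt a' b' \<in> border n I" "a < a'" for a b a' b'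
  proof (rule ccontr)
    assume "\<not> b \<le> b'"
    moreover have "rt a b \<in> I" "rt a' b' \<in> I" using that by (simp_all add: border)
    ultimately have "rt (Suc a) (b - 1) \<in> I"
      using up[of a' b' "Suc a" "b - 1"] idx[of a b] idx[of a' b'] \<open>a < a'\<close> by (auto simp: idx_iff)
    then show False using that by (simp add: border)
  qed
  have "bij_betw (\<lambda>(a, b). a + b) ?J {Suc (Suc i)..Suc (i + n)}"
    unfolding bij_betw_def
  proof (intro conjI equalityI subsetI)
    show "inj_on (\<lambda>(a, b). a + b) ?J"
    proof (rule inj_onI)
      fix p q assume pq: "p \<in> ?J" "q \<in> ?J" "(\<lambda>(a, b). a + b) p = (\<lambda>(a, b). a + b) q"
      then obtain a b a' b' where "p = (a, b)" "q = (a', b')" "a + b = a' + b'"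
        "rt a b \<in> border n I" "rt a' b' \<in> border n I" by auto
      then show "p = q"
        using mono[of a b a' b'] mono[of a' b' a b] by (cases rule: linorder_cases[of a a']) auto
    qed
  next
    fix d assume "d \<in> (\<lambda>(a, b). a + b) ` ?J"
    then obtain a b where d: "d = a + b" "rt a b \<in> border n I" by auto
    then have "rt a b \<in> I" by (simp add: border)
    from idx[OF this] le[OF this] gt[OF this]
    show "d \<in> {Suc (Suc i)..Suc (i + n)}" using d by (auto simp: idx_iff)
  next
    fix d assume d: "d \<in> {Suc (Suc i)..Suc (i + n)}"
    \<comment> \<open>The antidiagonal enters the rectangle in row 1 or, for larger
      \<open>d\<close>, in column \<open>n+1\<close>; the corners put this entry cell into the
      ideal.\<close>
    have "\<exists>a. rt a (d - a) \<in> I"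
    proof (cases "d \<le> Suc (Suc n)")
      case True
      then have "rt 1 (d - 1) \<in> I"
        using d up[OF corners(1), of 1 "d - 1"] i by (auto simp: idx_iff)
      then show ?thesis by blast
    next
      case False
      then have "rt (d - Suc n) (Suc n) \<in> I" "d - (d - Suc n) = Suc n"
        using d up[OF corners(2), of "d - Suc n" "Suc n"] i by (auto simp: idx_iff)
      then show ?thesis by metis
    qed
    then obtain a where a: "rt a (d - a) \<in> I" "rt (Suc a) (d - Suc a) \<notin> I"
      using greatest_with[of "\<lambda>a. rt a (d - a) \<in> I" _ i] le by blast
    then have "rt a (d - a) \<in> border n I" by (simp add: border)
    moreover have "d = a + (d - a)" using idx[OF a(1)] by simp
    ultimately show "d \<in> (\<lambda>(a, b). a + b) ` ?J" by (auto simp: image_iff)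
  qed
  then have "card ?J = card {Suc (Suc i)..Suc (i + n)}"
    by (rule bij_betw_same_card)
  then have card: "card ?J = n" by simp
  have "\<exists>b. rt a b \<in> border n I" if a: "a \<in> {1..i}" for a
  proof -
    have "rt a (Suc n) \<in> I"
      using up[OF corners(2), of a "Suc n"] a i by (auto simp: idx_iff)
    then have L: "rt a (LEAST b. rt a b \<in> I) \<in> I" by (rule LeastI)
    \<comment> \<open>The leftmost ideal cell of a row is on the border: with
      \<open>(a+1, b-1)\<close> the ideal would contain \<open>(a, b-1)\<close>. For a column, the
      lowest ideal cell works in the same way.\<close>
    define b where "b = (LEAST b. rt a b \<in> I)"
    have "rt (Suc a) (b - 1) \<notin> I"
    proof
      assume J: "rt (Suc a) (b - 1) \<in> I"
      then have "rt a (b - 1) \<in> I"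
        using up[OF J, of a "b - 1"] idx[OF J] a by (auto simp: idx_iff)
      then have "b \<le> b - 1" unfolding b_def by (rule Least_le)
      then show False using idx[OF J] by simp
    qed
    then show ?thesis using L by (auto simp: border b_def)
  qed
  moreover have "\<exists>a. rt a b \<in> border n I" if b: "b \<in> {Suc i..Suc n}" for b
  proof -
    have "rt 1 b \<in> I"
      using up[OF corners(1), of 1 b] b by (auto simp: idx_iff)
    then obtain a where a: "rt a b \<in> I" "rt (Suc a) b \<notin> I"
      using greatest_with[of "\<lambda>a. rt a b \<in> I" 1 i] le by blast
    have "rt (Suc a) (b - 1) \<notin> I"
    proof
      assume J: "rt (Suc a) (b - 1) \<in> I"
      then have "rt (Suc a) b \<in> I"
        using up[OF J, of "Suc a" b] idx[OF J] b by (auto simp: idx_iff)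
      then show False using a by simp
    qed
    then show ?thesis using a by (auto simp: border)
  qed
  moreover have "?J \<subseteq> {1..i} \<times> {Suc i..Suc n}"
  proof (clarify)
    fix a b assume "rt a b \<in> border n I"
    then have ab: "rt a b \<in> I" by (simp add: border)
    show "a \<in> {1..i} \<and> b \<in> {Suc i..Suc n}"
      using idx[OF ab] le[OF ab] gt[OF ab] by (simp add: idx_iff)
  qed
  ultimately show ?thesis
    using card mono unfolding staircase_def by auto
qed

text \<open>The ideal is the upper set generated by \<open>B\<close>; it is abelian because its rows
  are at most \<open>i\<close> and its columns exceed \<open>i\<close>. Monotonicity puts
  \<open>B\<close> into the border. The border is itself a staircase, so both have \<open>n\<close>
  elements, and this count replaces the other inclusion.\<close>

lemma staircase_is_border:
  assumes i: "i \<in> {1..n}" and B: "staircase n i B"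
  obtains I where "abelian_ideal n I" "rt 1 (Suc i) \<in> I" "rt i (Suc n) \<in> I"
    "border n I = (\<lambda>(a, b). rt a b) ` B"
proof -
  have Bsub: "B \<subseteq> {1..i} \<times> {Suc i..Suc n}" and cardB: "card B = n"
    and mono: "\<And>a b a' b'. (a, b) \<in> B \<Longrightarrow> (a', b') \<in> B \<Longrightarrow> a < a' \<Longrightarrow> b \<le> b'"
    using B unfolding staircase_def by blast+
  define I where
    "I = {rt a b | a b. a \<in> idx n \<and> b \<in> idx n \<and> (\<exists>a' b'. (a', b') \<in> B \<and> a \<le> a' \<and> b' \<le> b)}"
  have Bi: "1 \<le> a" "a \<le> i" "Suc i \<le> b" "b \<le> Suc n" if "(a, b) \<in> B" for a b
    using that Bsub by auto
  have mem: "rt a b \<in> I \<longleftrightarrow> a \<in> idx n \<and> b \<in> idx n \<and> (\<exists>a' b'. (a', b') \<in> B \<and> a \<le> a' \<and> b' \<le> b)"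
    if "a \<noteq> b" for a b
    using that unfolding I_def by (auto simp: rt_eq_iff)
  have shape: "\<exists>a b. x = rt a b \<and> 1 \<le> a \<and> a \<le> i \<and> i < b \<and> b \<le> Suc n" if "x \<in> I" for x
    using that Bi unfolding I_def by (fastforce simp: idx_iff)
  have sub: "I \<subseteq> pos_roots n"
  proof
    fix x assume "x \<in> I"
    then obtain a b where "x = rt a b" "1 \<le> a" "a \<le> i" "i < b" "b \<le> Suc n"
      using shape by blast
    then show "x \<in> pos_roots n" using i by (auto simp: rt_in_pos_roots idx_iff)
  qed
  have I: "abelian_ideal n I"
    unfolding abelian_ideal_def
  proof (intro conjI ballI impI sub)
    fix x y assume x: "x \<in> I" and y: "y \<in> pos_roots n" and ge: "root_ge n y x"
    obtain a b where ab: "x = rt a b" "1 \<le> a" "a \<le> i" "i < b" "b \<le> Suc n"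
      using shape[OF x] by blast
    obtain c d where cd: "y = rt c d" "c < d" "c \<in> idx n" "d \<in> idx n"
      using y by (auto simp: pos_roots_eq)
    have "c \<le> a" "b \<le> d"
      using ge x y sub by (auto simp: ab(1) cd(1) root_ge_rt)
    moreover obtain a' b' where "(a', b') \<in> B" "a \<le> a'" "b' \<le> b"
      using x ab mem[of a b] by auto
    ultimately have "(a', b') \<in> B \<and> c \<le> a' \<and> b' \<le> d" by simp
    then show "y \<in> I" using cd mem[of c d] by blast
  next
    fix x y assume "x \<in> I" "y \<in> I"
    then obtain a b c d where ab: "x = rt a b" "a \<le> i" "i < b" and cd: "y = rt c d" "c \<le> i" "i < d"
      using shape by meson
    show "x + y \<notin> roots n"
    proof
      assume "x + y \<in> roots n"
      then obtain p q where "rt a b + rt c d = rt p q"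
        by (auto simp: roots_eq ab cd)
      then have *: "rt a b k + rt c d k = rt p q k" for k
        by (metis plus_fun_apply)
      \<comment> \<open>Row indices never equal column indices, so no entry 1 cancels: the sum has
        an entry 2 or two entries 1, which no root has.\<close>
      show False
        using *[of a] *[of c] ab cd by (auto simp: rt_apply split: if_splits)
    qed
  qed
  have "1 \<in> {1..i}" "i \<in> {1..i}" "Suc i \<in> {Suc i..Suc n}"
    using i by auto
  then obtain a b where "(a, Suc i) \<in> B" "(i, b) \<in> B"
    using B unfolding staircase_def by meson
  then have corners: "rt 1 (Suc i) \<in> I" "rt i (Suc n) \<in> I"
    using i Bi[of a "Suc i"] Bi[of i b] by (auto simp: mem idx_iff)
  let ?f = "\<lambda>(a, b). rt a b"
  have inj: "inj_on ?f {(a, b). a < b}"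
    by (auto simp: inj_on_def rt_eq_iff)
  have "?f ` B \<subseteq> border n I"
  proof (clarify, unfold border_iff[OF sub], intro conjI notI)
    fix a b assume ab: "(a, b) \<in> B"
    from Bi[OF this] show "rt a b \<in> I"
      using ab i by (subst mem) (auto simp: idx_iff)
    assume J: "rt (Suc a) (b - 1) \<in> I"
    then have "rt (Suc a) (b - 1) \<in> pos_roots n" using sub by blast
    then have "Suc a \<noteq> b - 1" using rt_pos_rootsD(1) by fastforce
    then obtain a' b' where "(a', b') \<in> B" "Suc a \<le> a'" "b' \<le> b - 1"
      using J by (auto simp: mem)
    then show False using mono[OF ab, of a' b'] Bi[OF ab] by auto
  qed
  moreover have border: "border n I = ?f ` {(a, b). rt a b \<in> border n I}"
  proof (intro equalityI subsetI)
    fix x assume x: "x \<in> border n I"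
    then have "x \<in> pos_roots n" using sub by (auto simp: border_def)
    then obtain a b where "x = ?f (a, b)" by (auto simp: pos_roots_eq)
    then show "x \<in> ?f ` {(a, b). rt a b \<in> border n I}"
      using x by (intro image_eqI[of _ _ "(a, b)"]) simp_all
  next
    fix x assume "x \<in> ?f ` {(a, b). rt a b \<in> border n I}"
    then show "x \<in> border n I" by auto
  qed
  have stair: "staircase n i {(a, b). rt a b \<in> border n I}"
    using staircase_border[OF i I corners] .
  have "card (border n I) = n"
  proof -
    have "inj_on ?f {(a, b). rt a b \<in> border n I}"
    proof (rule inj_on_subset[OF inj], clarify)
      fix a b assume "rt a b \<in> border n I"
      then have "rt a b \<in> pos_roots n" using sub by (auto simp: border_def)
      then show "a < b" by (rule rt_pos_rootsD)
    qed
    then have "card (?f ` {(a, b). rt a b \<in> border n I}) = card {(a, b). rt a b \<in> border n I}"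
      by (rule card_image)
    then show ?thesis
      using stair unfolding border[symmetric] staircase_def by simp
  qed
  moreover have "card (?f ` B) = n"
  proof -
    have "inj_on ?f B"
      by (rule inj_on_subset[OF inj]) (use Bsub in auto)
    then show ?thesis by (simp add: card_image cardB)
  qed
  moreover have "finite (border n I)"
    using \<open>card (border n I) = n\<close> i by (intro card_ge_0_finite) auto
  ultimately have "border n I = ?f ` B"
    by (metis card_subset_eq)
  then show thesis using that I corners by blast
qed

section \<open>Anti-standard graphs\<close>

text \<open>This removes ideals and the affine group from the statement; what remains is
  combinatorics of staircases and permutations.\<close>

lemma border_Iab_iff_staircase:
  assumes "i \<in> {1..n}"
  shows "(\<exists>I\<in>Iab n (alpha i). X = border n I) \<longleftrightarrow>
    (\<exists>B. staircase n i B \<and> X = (\<lambda>(a, b). rt a b) ` B)"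
proof
  assume "\<exists>I\<in>Iab n (alpha i). X = border n I"
  then obtain I where I: "abelian_ideal n I" "rt 1 (Suc i) \<in> I" "rt i (Suc n) \<in> I"
    and X: "X = border n I"
    using assms by (auto simp: Iab_iff)
  have "X \<subseteq> pos_roots n"
    using abelian_ideal_subset[OF I(1)] by (auto simp: X border_def)
  have "X = (\<lambda>(a, b). rt a b) ` {(a, b). rt a b \<in> border n I}"
  proof (intro equalityI subsetI)
    fix x assume x: "x \<in> X"
    then obtain a b where "x = rt a b"
      using \<open>X \<subseteq> pos_roots n\<close> by (auto simp: pos_roots_eq)
    then show "x \<in> (\<lambda>(a, b). rt a b) ` {(a, b). rt a b \<in> border n I}"
      using x X by (intro image_eqI[of _ _ "(a, b)"]) auto
  qed (auto simp: X)
  then show "\<exists>B. staircase n i B \<and> X = (\<lambda>(a, b). rt a b) ` B"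
    using staircase_border[OF assms I] by blast
next
  assume "\<exists>B. staircase n i B \<and> X = (\<lambda>(a, b). rt a b) ` B"
  then obtain B where B: "staircase n i B" and X: "X = (\<lambda>(a, b). rt a b) ` B" by blast
  obtain I where "abelian_ideal n I" "rt 1 (Suc i) \<in> I" "rt i (Suc n) \<in> I"
    "border n I = (\<lambda>(a, b). rt a b) ` B"
    using staircase_is_border[OF assms B] .
  then show "\<exists>I\<in>Iab n (alpha i). X = border n I"
    using assms X by (intro bexI[of _ I]) (auto simp: Iab_iff)
qed

text \<open>The order condition compares sources with sources and targets with targets, and
  \<open>s\<close> is increasing on each of these blocks, so it survives the relabelling.\<close>

lemma anti_standard_of_staircase:
  assumes i: "i \<in> {1..n}" and B: "staircase n i B" and s: "s permutes idx n"
    and mono: "strict_mono_on {1..i} s" "strict_mono_on {Suc i..Suc n} s"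
  shows "anti_standard n ((\<lambda>(a, b). (s a, s b)) ` B)"
proof -
  let ?E = "(\<lambda>(a, b). (s a, s b)) ` B"
  have sub: "1 \<le> a" "a \<le> i" "i < b" "b \<le> Suc n" if "(a, b) \<in> B" for a b
    using that B unfolding staircase_def by auto
  have inj: "s a = s b \<longleftrightarrow> a = b" for a b
    using permutes_inj[OF s] by (simp add: inj_eq)
  have in_idx: "s a \<in> idx n \<longleftrightarrow> a \<in> idx n" for a
    by (rule permutes_in_image[OF s])
  have edge: "(s a, s b) \<in> ?E \<longleftrightarrow> (a, b) \<in> B" for a b
    by (auto simp: inj intro!: rev_image_eqI)
  have surj: "\<exists>a. v = s a" for v
    using permutes_surj[OF s] by (auto simp: surj_def)
  have "y \<le> y'" if xy: "(x, y) \<in> ?E" "(x', y') \<in> ?E" "x < x'" for x y x' y'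
  proof -
    obtain a b a' b' where eq: "x = s a" "y = s b" "x' = s a'" "y' = s b'"
      and ab: "(a, b) \<in> B" "(a', b') \<in> B"
      using xy by auto
    have "a < a'"
    proof (rule ccontr)
      assume "\<not> a < a'"
      then have "s a' \<le> s a"
        by (intro strict_mono_on_leD[OF mono(1)]) (use sub[OF ab(1)] sub[OF ab(2)] in simp_all)
      then show False using xy(3) eq by simp
    qed
    then have "b \<le> b'" using B ab unfolding staircase_def by blast
    then show ?thesis
      unfolding eq
      by (intro strict_mono_on_leD[OF mono(2)]) (use sub[OF ab(1)] sub[OF ab(2)] in simp_all)
  qed
  then have order_E: "\<forall>(x, y)\<in>?E. \<forall>(x', y')\<in>?E. x < x' \<longrightarrow> y \<le> y'"
    by (intro ballI) (simp only: split_paired_all prod.case, blast)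
  have "?E \<subseteq> {1..n+1} \<times> {1..n+1}"
  proof
    fix p assume "p \<in> ?E"
    then obtain a b where p: "p = (s a, s b)" and ab: "(a, b) \<in> B" by auto
    have "a \<in> idx n" "b \<in> idx n" using sub[OF ab] i by (auto simp: idx_iff)
    then show "p \<in> {1..n+1} \<times> {1..n+1}"
      using in_idx unfolding p idx_def[symmetric] by blast
  qed
  moreover have "\<forall>(x, y)\<in>?E. x \<noteq> y"
    using sub(2,3) by (fastforce simp: inj)
  moreover have "card ?E = n"
  proof -
    have "inj_on (\<lambda>(a, b). (s a, s b)) B"
      by (auto simp: inj_on_def inj)
    then show ?thesis using B by (simp add: card_image staircase_def)
  qed
  moreover have "\<forall>v\<in>{1..n+1}. (\<exists>t. (v, t) \<in> ?E) \<noteq> (\<exists>u. (u, v) \<in> ?E)"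
  proof
    fix v assume v: "v \<in> {1..n+1}"
    obtain a where a: "v = s a" using surj by blast
    have "a \<in> idx n" using v a in_idx[of a] by (simp add: idx_def)
    have "(\<exists>t. (v, t) \<in> ?E) \<longleftrightarrow> (\<exists>b. (a, b) \<in> B)" "(\<exists>u. (u, v) \<in> ?E) \<longleftrightarrow> (\<exists>b. (b, a) \<in> B)"
      unfolding a by (auto simp: inj)
    moreover have "(\<exists>b. (a, b) \<in> B) \<longleftrightarrow> a \<le> i"
      using B sub(2)[of a] \<open>a \<in> idx n\<close> by (auto simp: staircase_def idx_iff)
    moreover have "(\<exists>b. (b, a) \<in> B) \<longleftrightarrow> \<not> a \<le> i"
    proof
      assume "\<not> a \<le> i"
      then have "a \<in> {Suc i..Suc n}" using \<open>a \<in> idx n\<close> by (simp add: idx_iff)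
      then show "\<exists>b. (b, a) \<in> B" using B unfolding staircase_def by blast
    qed (use sub(3) in force)
    ultimately show "(\<exists>t. (v, t) \<in> ?E) \<noteq> (\<exists>u. (u, v) \<in> ?E)" by simp
  qed
  moreover note order_E
  ultimately show ?thesis
    unfolding anti_standard_def by (intro conjI)
qed

text \<open>Listing \<open>P\<close> and then its complement, each in increasing order, yields the
  minimal representative of the coset that \<open>P\<close> determines.\<close>

lemma sorting_perm:
  assumes P: "P \<subseteq> idx n" "card P = i"
  obtains s where "s permutes idx n" "s ` {1..i} = P" "s ` {Suc i..Suc n} = idx n - P"
    "strict_mono_on {1..i} s" "strict_mono_on {Suc i..Suc n} s"
proof -
  have fin: "finite P" "finite (idx n - P)"
    using P by (auto intro: finite_subset)
  have i: "i \<le> Suc n" using card_mono[OF finite_idx P(1)] P(2) by simp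
  have cards: "card (idx n - P) = Suc n - i"
    using P fin by (simp add: card_Diff_subset)
  obtain f where f: "bij_betw f {..<i} P" "strict_mono_on {..<i} f"
    using ex_bij_betw_strict_mono_card[OF fin(1)] P(2) by metis
  obtain g where g: "bij_betw g {..<Suc n - i} (idx n - P)" "strict_mono_on {..<Suc n - i} g"
    using ex_bij_betw_strict_mono_card[OF fin(2)] cards by metis
  \<comment> \<open>\<open>f\<close> and \<open>g\<close> count from 0 while the blocks start at
    \<open>1\<close> and \<open>Suc i\<close>, hence the offsets.\<close>
  define s where "s c = (if c \<in> {1..i} then f (c - 1)
    else if c \<in> {Suc i..Suc n} then g (c - Suc i) else c)" for c
  have "bij_betw (\<lambda>c. c - 1) {1..i} {..<i}"
    by (rule bij_betw_byWitness[where f' = Suc]) auto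
  from bij_betw_trans[OF this f(1)] have s1: "bij_betw s {1..i} P"
    by (rule bij_betw_cong[THEN iffD1, rotated]) (auto simp: s_def)
  have "bij_betw (\<lambda>c. c - Suc i) {Suc i..Suc n} {..<Suc n - i}"
    by (rule bij_betw_byWitness[where f' = "\<lambda>c. c + Suc i"]) auto
  from bij_betw_trans[OF this g(1)] have s2: "bij_betw s {Suc i..Suc n} (idx n - P)"
    by (rule bij_betw_cong[THEN iffD1, rotated]) (auto simp: s_def)
  have "bij_betw s ({1..i} \<union> {Suc i..Suc n}) (P \<union> (idx n - P))"
    using s1 s2 by (rule bij_betw_combine) auto
  moreover have "{1..i} \<union> {Suc i..Suc n} = idx n" "P \<union> (idx n - P) = idx n"
    using i P by (auto simp: idx_iff)
  ultimately have "s permutes idx n"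
    by (intro bij_imp_permutes) (use i in \<open>auto simp: s_def idx_iff\<close>)
  moreover have "strict_mono_on {1..i} s"
    by (rule strict_mono_onI) (auto simp: s_def intro!: strict_mono_onD[OF f(2)])
  moreover have "strict_mono_on {Suc i..Suc n} s"
    by (rule strict_mono_onI) (auto simp: s_def intro!: strict_mono_onD[OF g(2)])
  ultimately show thesis
    using that s1 s2 by (simp add: bij_betw_imp_surj_on)
qed

text \<open>\<open>s\<close> sorts the set of sources to the front; pulling the edges back along
  \<open>s\<close> gives the cells.\<close>

lemma staircase_of_anti_standard:
  assumes n: "n \<ge> 1" and E: "anti_standard n E"
  obtains i s B where "i \<in> {1..n}" "s permutes idx n"
    "strict_mono_on {1..i} s" "strict_mono_on {Suc i..Suc n} s"
    "staircase n i B" "E = (\<lambda>(a, b). (s a, s b)) ` B"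
proof -
  have Esub: "E \<subseteq> idx n \<times> idx n" and cardE: "card E = n"
    and part: "\<And>v. v \<in> idx n \<Longrightarrow> (\<exists>t. (v, t) \<in> E) \<noteq> (\<exists>u. (u, v) \<in> E)"
    and mono: "\<And>x y x' y'. (x, y) \<in> E \<Longrightarrow> (x', y') \<in> E \<Longrightarrow> x < x' \<Longrightarrow> y \<le> y'"
    using E unfolding anti_standard_def idx_def by blast+
  define P i where "P = fst ` E" and "i = card P"
  have P: "P \<subseteq> idx n" using Esub by (auto simp: P_def)
  have src: "v \<in> P \<longleftrightarrow> (\<exists>t. (v, t) \<in> E)" for v
    by (force simp: P_def)
  have tgt: "v \<in> idx n - P \<longleftrightarrow> (\<exists>u. (u, v) \<in> E)" for v
    using part[of v] src[of v] Esub by auto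
  have "finite E" using cardE n by (intro card_ge_0_finite) auto
  \<comment> \<open>One edge suffices to bound \<open>i\<close>: its source lies in \<open>P\<close>
    and its target outside.\<close>
  obtain x y where "(x, y) \<in> E"
    using cardE n by (cases "E = {}") auto
  then have "x \<in> P" "y \<in> idx n - P" using src tgt by blast+
  then have "P \<noteq> {}" "P \<subset> idx n" using P by auto
  then have "0 < i" "i < Suc n"
    unfolding i_def using psubset_card_mono[OF finite_idx, of P n] finite_subset[OF P]
    by (auto simp: card_gt_0_iff)
  then have i: "i \<in> {1..n}" by simp
  obtain s where s: "s permutes idx n" "s ` {1..i} = P" "s ` {Suc i..Suc n} = idx n - P"
    and smono: "strict_mono_on {1..i} s" "strict_mono_on {Suc i..Suc n} s"
    using sorting_perm[OF P, of i] i_def by metis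
  define B where "B = {(a, b). (s a, s b) \<in> E}"
  have inj: "s a = s b \<longleftrightarrow> a = b" for a b
    using permutes_inj[OF s(1)] by (simp add: inj_eq)
  have surj: "\<exists>a. v = s a" for v
    using permutes_surj[OF s(1)] by (auto simp: surj_def)
  have EB: "E = (\<lambda>(a, b). (s a, s b)) ` B"
  proof (intro equalityI subsetI)
    fix p assume p: "p \<in> E"
    obtain a b where "p = (s a, s b)" using surj by (metis surj_pair)
    then show "p \<in> (\<lambda>(a, b). (s a, s b)) ` B"
      using p by (auto simp: B_def intro!: image_eqI[of _ _ "(a, b)"])
  qed (auto simp: B_def)
  have left: "s a \<in> P \<longleftrightarrow> a \<in> {1..i}" for a
    unfolding s(2)[symmetric] by (auto simp: image_iff inj)
  have right: "s b \<in> idx n - P \<longleftrightarrow> b \<in> {Suc i..Suc n}" for b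
    unfolding s(3)[symmetric] by (auto simp: image_iff inj)
  have "staircase n i B"
    unfolding staircase_def
  proof (intro conjI ballI allI impI)
    show "B \<subseteq> {1..i} \<times> {Suc i..Suc n}"
      unfolding B_def using src tgt left right by blast
    have "inj_on (\<lambda>(a, b). (s a, s b)) B" by (auto simp: inj_on_def inj)
    then show "card B = n" using cardE EB by (simp add: card_image)
  next
    fix a assume "a \<in> {1..i}"
    then obtain t where "(s a, t) \<in> E" using left src by blast
    then show "\<exists>b. (a, b) \<in> B" using surj[of t] by (auto simp: B_def)
  next
    fix b assume "b \<in> {Suc i..Suc n}"
    then obtain u where "(u, s b) \<in> E" using right tgt by blast
    then show "\<exists>a. (a, b) \<in> B" using surj[of u] by (auto simp: B_def)
  next
    fix a b a' b' assume ab: "(a, b) \<in> B" "(a', b') \<in> B" "a < a'"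
    have a: "a \<in> {1..i}" "a' \<in> {1..i}" and b: "b \<in> {Suc i..Suc n}" "b' \<in> {Suc i..Suc n}"
      using ab left right src tgt unfolding B_def by blast+
    have "s a < s a'" using smono(1) a ab(3) by (auto intro: strict_mono_onD)
    then have "s b \<le> s b'" using mono ab by (auto simp: B_def)
    then show "b \<le> b'"
      using smono(2) b by (meson not_le strict_mono_onD)
  qed
  then show thesis using that i s(1) smono EB by blast
qed

lemma graph_roots_eq:
  assumes "anti_standard n E"
  shows "graph_roots E = (\<lambda>(x, y). rt x y) ` E"
  unfolding graph_roots_def
  by (rule image_cong) (use assms in \<open>auto simp: anti_standard_def edge_root_eq_rt\<close>)

theorem theorem7p2:
  fixes n :: nat and S :: "vec set"
  assumes "n \<ge> 1"
  shows "(\<exists>i\<in>{1..n}. \<exists>w\<in>Wi n i. \<exists>I\<in>Iab n (alpha i). S = w ` border n I)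
     \<longleftrightarrow> (\<exists>E. anti_standard n E \<and> S = graph_roots E)"
proof -
  \<comment> \<open>Acting on roots amounts to relabelling the vertices of the edges.\<close>
  have act: "perm_act s ` (\<lambda>(a, b). rt a b) ` B = (\<lambda>(x, y). rt x y) ` (\<lambda>(a, b). (s a, s b)) ` B"
    if "s permutes idx n" for s and B :: "(nat \<times> nat) set"
    using permutes_bij[OF that] by (auto simp: image_image perm_act_rt intro!: image_cong)
  show ?thesis
  proof
    assume "\<exists>i\<in>{1..n}. \<exists>w\<in>Wi n i. \<exists>I\<in>Iab n (alpha i). S = w ` border n I"
    then obtain i w I where i: "i \<in> {1..n}" and w: "w \<in> Wi n i"
      and I: "I \<in> Iab n (alpha i)" and S: "S = w ` border n I" by blast
    obtain s where s: "w = perm_act s" "s permutes idx n"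
      "strict_mono_on {1..i} s" "strict_mono_on {Suc i..Suc n} s"
      using w unfolding Wi_eq[OF i] by blast
    obtain B where B: "staircase n i B" "border n I = (\<lambda>(a, b). rt a b) ` B"
      using iffD1[OF border_Iab_iff_staircase[OF i], of "border n I"] I by blast
    have E: "anti_standard n ((\<lambda>(a, b). (s a, s b)) ` B)"
      using anti_standard_of_staircase[OF i B(1) s(2-4)] .
    have "S = graph_roots ((\<lambda>(a, b). (s a, s b)) ` B)"
      unfolding S s(1) B(2) act[OF s(2)] graph_roots_eq[OF E] ..
    with E show "\<exists>E. anti_standard n E \<and> S = graph_roots E" by blast
  next
    assume "\<exists>E. anti_standard n E \<and> S = graph_roots E"
    then obtain E where E: "anti_standard n E" and S: "S = graph_roots E" by blast
    obtain i s B where i: "i \<in> {1..n}" and s: "s permutes idx n"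
        "strict_mono_on {1..i} s" "strict_mono_on {Suc i..Suc n} s"
      and B: "staircase n i B" and EB: "E = (\<lambda>(a, b). (s a, s b)) ` B"
      using staircase_of_anti_standard[OF assms E] .
    have "perm_act s \<in> Wi n i" using s unfolding Wi_eq[OF i] by blast
    moreover obtain I where "I \<in> Iab n (alpha i)" "border n I = (\<lambda>(a, b). rt a b) ` B"
      using iffD2[OF border_Iab_iff_staircase[OF i], of "(\<lambda>(a, b). rt a b) ` B"] B by metis
    moreover have "S = perm_act s ` (\<lambda>(a, b). rt a b) ` B"
      unfolding S graph_roots_eq[OF E] unfolding EB act[OF s(1)] ..
    ultimately show "\<exists>i\<in>{1..n}. \<exists>w\<in>Wi n i. \<exists>I\<in>Iab n (alpha i). S = w ` border n I"
      using i by metis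
  qed
qed

end
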